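(* Let $\Gamma\subset\mathbb R$ be an additive subgroup containing $\mathbb Z$. If $A,B\in\mathcal A_\Gamma$ with $A,B\notin\mathcal V_{\mathrm{flat}}$, then $$\operatorname{ord}_\Gamma(AB)=\operatorname{ord}_\Gamma A+\operatorname{ord}_\Gamma B .$$ For $\lambda\in\mathbb R$ set $\mathcal F_\lambda=\{A\in\mathcal A_\Gamma:\operatorname{ord}_\Gamma A\le\lambda\}$. Then $(\mathcal F_\lambda)_{\lambda\in\mathbb R}$ is an increasing filtration by complex vector subspaces, and $\mathcal F_\lambda\mathcal F_\mu\subseteq\mathcal F_{\lambda+\mu}$ for all $\lambda,\mu\in\mathbb R$.
   Context: Fix $T>0$; functions are complex-valued. Let $\mathcal M=\{f\in C^\infty[0,T]: f^{(n)}(0)=0\text{ for all }n\ge 0\}$. For $\mu>0$ put $(J^\mu f)(t)=\frac1{\Gamma(\mu)}\int_0^t(t-s)^{\mu-1}f(s)\,ds$ (here $\Gamma(\cdot)$ is the gamma function). On $\mathcal M$ define $D^{-\mu}=J^\mu$ for $\mu>0$, $D^0=I$, and for $\alpha>0$, $D^\alpha f=J^{n-\alpha}f^{(n)}$ for any integer $n>\alpha$; each $D^\alpha$, $\alpha\in\mathbb R$, is a bijection of $\mathcal M$ and $D^\alpha D^\beta=D^{\alpha+\beta}$. For $p\in\mathbb C[t]$, $M_p$ is multiplication by $p$. For $k\in\mathcal M$, $(V_kf)(t)=\int_0^tk(t-s)f(s)\,ds$; for a bivariate kernel $K$ on $\{0\le s\le t\le T\}$, $(V_Kf)(t)=\int_0^tK(t,s)f(s)\,ds$.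 $\mathcal K_{\mathrm{flat}}$ is the set of finite sums $K(t,s)=\sum_{r=1}^{N}p_r(t)k_r(t-s)$ with $p_r\in\mathbb C[t]$, $k_r\in\mathcal M$, and $\mathcal V_{\mathrm{flat}}=\{V_K:K\in\mathcal K_{\mathrm{flat}}\}$. $\mathcal A_\Gamma$ is the subalgebra of $\operatorname{End}_{\mathbb C}(\mathcal M)$ generated by $\{M_p:p\in\mathbb C[t]\}$, $\{D^\gamma:\gamma\in\Gamma\}$ and $\{V_k:k\in\mathcal M\}$. Every $A\in\mathcal A_\Gamma$ has a unique finite normal form $A=\sum_{\gamma\in F}M_{p_\gamma}D^\gamma+V_K$ with $F\subset\Gamma$ finite, $p_\gamma\in\mathbb C[t]$, $K\in\mathcal K_{\mathrm{flat}}$; for $A\notin\mathcal V_{\mathrm{flat}}$ define $\operatorname{ord}_\Gamma A=\max\{\gamma:p_\gamma\ne0\}$, and put $\operatorname{ord}_\Gamma A=-\infty$ for $A\in\mathcal V_{\mathrm{flat}}$. *)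

theory Defs
  imports "HOL-Analysis.Analysis" "HOL-Library.Function_Algebras" "HOL-Computational_Algebra.Polynomial"
begin

text \<open>
  A function on \<open>[0,T]\<close> is represented by a total function vanishing outside \<open>{0..T}\<close>, and
  an operator on \<open>\<M>\<close> by a total operator vanishing outside the carrier \<open>flat T\<close> of \<open>\<M>\<close>.
  With these conventions HOL equality is equality of functions on \<open>[0,T]\<close>, respectively of
  operators on \<open>\<M>\<close>; the linear operations are the pointwise ones, and the product of
  operators is composition \<open>\<circ>\<close> (not the pointwise \<open>*\<close> of \<open>Function_Algebras\<close>).
\<close>

type_synonym cfun = "real \<Rightarrow> complex"
type_synonym oper = "cfun \<Rightarrow> cfun"

text \<open>The derivative is one-sided at the end points of \<open>[0,T]\<close>.\<close>

definition deriv_on :: "real \<Rightarrow> cfun \<Rightarrow> cfun" where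
  "deriv_on T f = (\<lambda>t. if t \<in> {0..T} then vector_derivative f (at t within {0..T}) else 0)"

definition flat :: "real \<Rightarrow> cfun set" where
  "flat T = {f. (\<forall>t. t \<notin> {0..T} \<longrightarrow> f t = 0) \<and>
                (\<forall>n. ((deriv_on T ^^ n) f) differentiable_on {0..T}) \<and>
                (\<forall>n. (deriv_on T ^^ n) f 0 = 0)}"

definition frac_int :: "real \<Rightarrow> real \<Rightarrow> oper" where
  "frac_int T \<mu> f = (\<lambda>t. if t \<in> {0..T}
      then of_real (1 / Gamma \<mu>) * integral {0..t} (\<lambda>s. of_real ((t - s) powr (\<mu> - 1)) * f s)
      else 0)"

text \<open>
  For \<open>\<alpha> > 0\<close> the least integer \<open>n > \<alpha>\<close> is used; on flat functions
  \<open>J\<^bsup>n-\<alpha>\<^esup> f\<^bsup>(n)\<^esup>\<close> does not depend on the choice of the integer \<open>n > \<alpha>\<close>.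
\<close>

definition frac_deriv :: "real \<Rightarrow> real \<Rightarrow> oper" where
  "frac_deriv T \<alpha> f =
     (if \<alpha> < 0 then frac_int T (- \<alpha>) f
      else if \<alpha> = 0 then f
      else let n = nat (\<lfloor>\<alpha>\<rfloor> + 1) in frac_int T (real n - \<alpha>) ((deriv_on T ^^ n) f))"

definition volterra :: "real \<Rightarrow> (real \<Rightarrow> real \<Rightarrow> complex) \<Rightarrow> oper" where
  "volterra T K f = (\<lambda>t. if t \<in> {0..T} then integral {0..t} (\<lambda>s. K t s * f s) else 0)"

definition on_flat :: "real \<Rightarrow> oper \<Rightarrow> oper" where
  "on_flat T A = (\<lambda>f. if f \<in> flat T then A f else 0)"

definition mult_op :: "real \<Rightarrow> complex poly \<Rightarrow> oper" where
  "mult_op T p = on_flat T (\<lambda>f t. poly p (of_real t) * f t)"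

definition deriv_op :: "real \<Rightarrow> real \<Rightarrow> oper" where
  "deriv_op T \<gamma> = on_flat T (frac_deriv T \<gamma>)"

definition kernel_op :: "real \<Rightarrow> (real \<Rightarrow> real \<Rightarrow> complex) \<Rightarrow> oper" where
  "kernel_op T K = on_flat T (volterra T K)"

definition conv_op :: "real \<Rightarrow> cfun \<Rightarrow> oper" where
  "conv_op T k = kernel_op T (\<lambda>t s. k (t - s))"

definition flat_kernels :: "real \<Rightarrow> (real \<Rightarrow> real \<Rightarrow> complex) set" where
  "flat_kernels T =
     {(\<lambda>t s. if 0 \<le> s \<and> s \<le> t \<and> t \<le> T
             then \<Sum>r = 1..N. poly (p r) (of_real t) * k r (t - s) else 0)
      | (N :: nat) p k. \<forall>r \<in> {1..N}. k r \<in> flat T}"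

definition flat_volterra :: "real \<Rightarrow> oper set" where
  "flat_volterra T = kernel_op T ` flat_kernels T"

definition cscale :: "complex \<Rightarrow> oper \<Rightarrow> oper" where
  "cscale c A = (\<lambda>f t. c * A f t)"

lemma vector_space_cscale: "vector_space cscale"
  by unfold_locales (auto simp: cscale_def fun_eq_iff algebra_simps)

text \<open>The generated subalgebra is unital, since \<open>mult_op T 1\<close> is the identity of \<open>\<M>\<close>.\<close>

inductive_set frac_alg :: "real \<Rightarrow> real set \<Rightarrow> oper set" for T :: real and \<Gamma> :: "real set" where
  mult: "mult_op T p \<in> frac_alg T \<Gamma>"
| deriv: "\<gamma> \<in> \<Gamma> \<Longrightarrow> deriv_op T \<gamma> \<in> frac_alg T \<Gamma>"
| conv: "k \<in> flat T \<Longrightarrow> conv_op T k \<in> frac_alg T \<Gamma>"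
| add: "A \<in> frac_alg T \<Gamma> \<Longrightarrow> B \<in> frac_alg T \<Gamma> \<Longrightarrow> A + B \<in> frac_alg T \<Gamma>"
| scale: "A \<in> frac_alg T \<Gamma> \<Longrightarrow> cscale c A \<in> frac_alg T \<Gamma>"
| comp: "A \<in> frac_alg T \<Gamma> \<Longrightarrow> B \<in> frac_alg T \<Gamma> \<Longrightarrow> A \<circ> B \<in> frac_alg T \<Gamma>"

text \<open>
  The coefficients \<open>p\<^sub>\<gamma>\<close> of a normal form are given as a finitely supported function of
  \<open>\<gamma>\<close>, so that normal forms differing only by zero terms are identified.
\<close>

definition normal_form ::
  "real \<Rightarrow> real set \<Rightarrow> oper \<Rightarrow> (real \<Rightarrow> complex poly) \<Rightarrow> (real \<Rightarrow> real \<Rightarrow> complex) \<Rightarrow> bool" where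
  "normal_form T \<Gamma> A p K \<longleftrightarrow>
     finite {\<gamma>. p \<gamma> \<noteq> 0} \<and> {\<gamma>. p \<gamma> \<noteq> 0} \<subseteq> \<Gamma> \<and> K \<in> flat_kernels T \<and>
     A = (\<Sum>\<gamma> | p \<gamma> \<noteq> 0. mult_op T (p \<gamma>) \<circ> deriv_op T \<gamma>) + kernel_op T K"

definition coeffs_of :: "real \<Rightarrow> real set \<Rightarrow> oper \<Rightarrow> real \<Rightarrow> complex poly" where
  "coeffs_of T \<Gamma> A = (THE p. \<exists>K. normal_form T \<Gamma> A p K)"

definition ord_op :: "real \<Rightarrow> real set \<Rightarrow> oper \<Rightarrow> ereal" where
  "ord_op T \<Gamma> A =
     (if A \<in> flat_volterra T then - \<infinity> else ereal (Max {\<gamma>. coeffs_of T \<Gamma> A \<gamma> \<noteq> 0}))"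

definition filt :: "real \<Rightarrow> real set \<Rightarrow> real \<Rightarrow> oper set" where
  "filt T \<Gamma> r = {A \<in> frac_alg T \<Gamma>. ord_op T \<Gamma> A \<le> ereal r}"

end

theory Submission
  imports Defs
begin

text \<open>
  A normal form is a sum of terms \<open>M\<^sub>p D\<^sup>\<gamma>\<close> and an operator \<open>V\<^sub>K\<close>, and its order is the largest exponent
  \<open>\<gamma>\<close>. Two things make the order additive: composing two such terms produces
  \<open>M\<^sub>p\<^sub>q D\<^sup>\<alpha>\<^sup>+\<^sup>\<beta>\<close> up to terms of order at most \<open>\<alpha> + \<beta> - 1\<close>, where \<open>p q \<noteq> 0\<close> because
  \<open>\<complex>[t]\<close> is a domain; and a term \<open>M\<^sub>p D\<^sup>a\<close> with \<open>p \<noteq> 0\<close> is never cancelled by terms of order below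
  \<open>a\<close>, so that the order does not depend on how an operator is written.

  The first point is algebra. Writing \<open>t\<close> for multiplication by the variable, from \<open>D\<^sup>\<alpha> D\<^sup>\<beta> = D\<^sup>\<alpha>\<^sup>+\<^sup>\<beta>\<close>, \<open>D\<^sup>\<alpha> t = t D\<^sup>\<alpha> + \<alpha> D\<^sup>\<alpha>\<^sup>-\<^sup>1\<close>,
  \<open>D\<^sup>\<alpha> V\<^sub>k = V\<^sub>k D\<^sup>\<alpha>\<close>, which is the convolution operator with kernel \<open>D\<^sup>\<alpha> k\<close>, and
  \<open>V\<^sub>k t = t V\<^sub>k - V\<^sub>t\<^sub>k\<close> it follows by induction on polynomials that the set \<open>order_le T \<Gamma> r\<close> of all sums
  of terms of exponent at most \<open>r\<close> and of operators \<open>V\<^sub>K\<close> is multiplicative in \<open>r\<close>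
  (\<open>order_le_compose\<close>), that the operators \<open>V\<^sub>K\<close> form an ideal, and that leading terms multiply
  (\<open>leading_term_compose\<close>). The sets \<open>order_le T \<Gamma> r\<close> turn out to be the members of the
  filtration (\<open>filt_eq_order_le\<close>), and the statements on the filtration are immediate for them.

  The relations themselves come from one representation. Integration by parts shows that
  \<open>D\<^sup>\<alpha> f\<close> is the convolution of \<open>f\<^sup>(\<^sup>n\<^sup>)\<close> with \<open>t\<^sup>n\<^sup>-\<^sup>\<alpha>\<^sup>-\<^sup>1 / \<Gamma>(n - \<alpha>)\<close> for every
  natural number \<open>n > \<alpha>\<close> (\<open>frac_deriv_eq_conv\<close>); for \<open>n > \<alpha> + 1\<close> the kernel is continuous and vanishes at
  \<open>0\<close>, and everything reduces to the commutative and associative convolution of continuous functions,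
  to the Beta integral, and to the fact that convolution commutes with differentiation of flat functions.

  The second point is analysis (\<open>leading_term_nonzero\<close>). Suppose \<open>M\<^sub>p D\<^sup>a + X = 0\<close> with \<open>X\<close> of
  smaller order. Composing with \<open>D\<^sup>-\<^sup>a\<^sup>-\<^sup>2\<close> and fixing the time \<open>t\<close> gives a convolution of an arbitrary flat
  function with the kernel \<open>p(t) u + G(u)\<close>, where \<open>G(u) = o(u)\<close> as \<open>u \<rightarrow> 0\<close>. Flat functions are
  plentiful enough to detect a continuous kernel: multiply \<open>exp(-1/t)\<close> by polynomials and use the Weierstrass
  approximation theorem. So the kernel is zero, and dividing by \<open>u\<close> yields \<open>p(t) = 0\<close>.
\<close>

section \<open>Flat functions\<close>

locale interval =
  fixes T :: real
  assumes T_pos: "T > 0"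
begin

lemma deriv_on_eqI:
  assumes "\<And>t. t \<in> {0..T} \<Longrightarrow> (f has_vector_derivative d t) (at t within {0..T})"
    and "\<And>t. t \<notin> {0..T} \<Longrightarrow> d t = 0"
  shows "deriv_on T f = d"
proof
  fix t
  show "deriv_on T f t = d t"
  proof (cases "t \<in> {0..T}")
    case True
    have "vector_derivative f (at t within {0..T}) = d t"
      using vector_derivative_within_closed_interval[OF T_pos True assms(1)[OF True]] .
    then show ?thesis using True by (simp add: deriv_on_def)
  next
    case False
    then show ?thesis using assms(2) by (auto simp: deriv_on_def)
  qed
qed

text \<open>
  Flatness involves all iterated derivatives at once. It suffices to exhibit a set of functions
  vanishing at the left end point that is closed under differentiation; every closure property of
  \<open>flat T\<close> below is obtained in this way.
\<close>

lemma flat_coinduct [consumes 1, case_names outside zero deriv]: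
  assumes "f \<in> S"
    and outside: "\<And>f t. f \<in> S \<Longrightarrow> t \<notin> {0..T} \<Longrightarrow> f t = 0"
    and zero: "\<And>f. f \<in> S \<Longrightarrow> f 0 = 0"
    and deriv: "\<And>f. f \<in> S \<Longrightarrow> \<exists>d\<in>S. \<forall>t\<in>{0..T}. (f has_vector_derivative d t) (at t within {0..T})"
  shows "f \<in> flat T"
proof -
  have step: "deriv_on T g \<in> S" if "g \<in> S" for g
  proof -
    from deriv[OF that] obtain d
      where d: "d \<in> S" "\<forall>t\<in>{0..T}. (g has_vector_derivative d t) (at t within {0..T})"
      by blast
    have "deriv_on T g = d"
      using d outside by (intro deriv_on_eqI) auto
    then show ?thesis using d(1) by simp
  qed
  have iter: "(deriv_on T ^^ n) f \<in> S" for n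
    by (induction n) (auto simp: assms(1) step)
  have "(deriv_on T ^^ n) f differentiable_on {0..T}" for n
    using deriv[OF iter[of n]]
    by (auto simp: differentiable_on_def has_vector_derivative_def intro: differentiableI)
  then show ?thesis
    using outside[OF assms(1)] zero[OF iter] unfolding flat_def by blast
qed

lemma flat_outside: "f \<in> flat T \<Longrightarrow> t \<notin> {0..T} \<Longrightarrow> f t = 0"
  by (auto simp: flat_def)

lemma flat_iff:
  "f \<in> flat T \<longleftrightarrow> (\<forall>t. t \<notin> {0..T} \<longrightarrow> f t = 0) \<and>
    (\<forall>n. (deriv_on T ^^ n) f differentiable_on {0..T} \<and> (deriv_on T ^^ n) f 0 = 0)"
  unfolding flat_def by auto

lemma flat_funpowD:
  assumes "f \<in> flat T"
  shows "(deriv_on T ^^ n) f differentiable_on {0..T}" "(deriv_on T ^^ n) f 0 = 0"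
  using assms by (simp_all add: flat_iff)

lemma flat_0: "f \<in> flat T \<Longrightarrow> f 0 = 0"
  using flat_funpowD(2)[of f 0] by simp

lemma flat_deriv_on:
  assumes "f \<in> flat T" shows "deriv_on T f \<in> flat T"
proof -
  have eq: "(deriv_on T ^^ n) (deriv_on T f) = (deriv_on T ^^ Suc n) f" for n
    by (simp only: funpow_Suc_right o_apply)
  show ?thesis
    unfolding flat_iff eq using flat_funpowD[OF assms, of "Suc n" for n]
    by (auto simp: deriv_on_def simp del: funpow.simps)
qed

lemma flat_deriv_on_funpow: "f \<in> flat T \<Longrightarrow> (deriv_on T ^^ n) f \<in> flat T"
  by (induction n) (auto intro: flat_deriv_on)

lemma flat_has_vector_derivative:
  assumes "f \<in> flat T" "t \<in> {0..T}"
  shows "(f has_vector_derivative deriv_on T f t) (at t within {0..T})"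
proof -
  have "f differentiable_on {0..T}"
    using flat_funpowD(1)[OF assms(1), of 0] by simp
  then have "f differentiable (at t within {0..T})"
    using assms(2) by (auto simp: differentiable_on_def)
  then show ?thesis
    using assms(2) by (simp add: deriv_on_def vector_derivative_works)
qed

lemma flat_lincomb:
  assumes "f \<in> flat T" "g \<in> flat T"
  shows "(\<lambda>t. a * f t + b * g t) \<in> flat T"
proof -
  let ?S = "{\<lambda>t. a * f t + b * g t | f g. f \<in> flat T \<and> g \<in> flat T}"
  have "(\<lambda>t. a * f t + b * g t) \<in> ?S" using assms by blast
  then show ?thesis
  proof (coinduct rule: flat_coinduct)
    case (deriv h)
    then obtain f g where h: "h = (\<lambda>t. a * f t + b * g t)" "f \<in> flat T" "g \<in> flat T" by blast
    have "(h has_vector_derivative a * deriv_on T f t + b * deriv_on T g t) (at t within {0..T})"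
      if "t \<in> {0..T}" for t
      unfolding h(1) using that h(2,3)
      by (auto intro!: derivative_eq_intros flat_has_vector_derivative)
    then show ?case
      by (intro bexI[of _ "\<lambda>t. a * deriv_on T f t + b * deriv_on T g t"] ballI CollectI
            exI[of _ "deriv_on T f"] exI[of _ "deriv_on T g"] conjI refl flat_deriv_on h)
  qed (auto simp: flat_outside flat_0)
qed

lemma flat_add: "f \<in> flat T \<Longrightarrow> g \<in> flat T \<Longrightarrow> (\<lambda>t. f t + g t) \<in> flat T"
  using flat_lincomb[of f g 1 1] by simp

lemma flat_scale: "f \<in> flat T \<Longrightarrow> (\<lambda>t. c * f t) \<in> flat T"
  using flat_lincomb[of f f c 0] by simp

lemma flat_zero: "(\<lambda>t. 0) \<in> flat T"
  by (rule flat_coinduct[where S = "{\<lambda>t. 0}"]) auto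

text \<open>
  The set \<open>{t f}\<close> is not closed under differentiation, but \<open>{t f + g}\<close> is, since
  \<open>(t f + g)' = t f' + (f + g')\<close>.
\<close>

lemma flat_mult_t:
  assumes "f \<in> flat T"
  shows "(\<lambda>t. of_real t * f t) \<in> flat T"
proof -
  let ?S = "{\<lambda>t. of_real t * f t + g t | f g. f \<in> flat T \<and> g \<in> flat T}"
  have "(\<lambda>t. of_real t * f t) \<in> ?S"
    using assms flat_zero by (intro CollectI exI[of _ f] exI[of _ "\<lambda>t. 0"]) auto
  then show ?thesis
  proof (coinduct rule: flat_coinduct)
    case (deriv h)
    then obtain f g where h: "h = (\<lambda>t. of_real t * f t + g t)" "f \<in> flat T" "g \<in> flat T" by blast
    have "(h has_vector_derivative of_real t * deriv_on T f t + (f t + deriv_on T g t)) (at t within {0..T})"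
      if "t \<in> {0..T}" for t
      unfolding h(1) using that h(2,3)
      by (auto intro!: derivative_eq_intros flat_has_vector_derivative)
    then show ?case
      by (intro bexI[of _ "\<lambda>t. of_real t * deriv_on T f t + (f t + deriv_on T g t)"] ballI CollectI
            exI[of _ "deriv_on T f"] exI[of _ "\<lambda>t. f t + deriv_on T g t"] conjI refl flat_deriv_on flat_add h)
  qed (auto simp: flat_outside flat_0)
qed

lemma flat_mult_poly: "f \<in> flat T \<Longrightarrow> (\<lambda>t. poly p (of_real t) * f t) \<in> flat T"
proof (induction p)
  case (pCons a p)
  then show ?case
    using flat_lincomb[OF pCons.prems flat_mult_t[OF pCons.IH[OF pCons.prems]], of a 1]
    by (simp add: algebra_simps)
qed (simp add: flat_zero)

lemma deriv_on_lincomb: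
  assumes "f \<in> flat T" "g \<in> flat T"
  shows "deriv_on T (\<lambda>t. a * f t + b * g t) = (\<lambda>t. a * deriv_on T f t + b * deriv_on T g t)"
  using assms
  by (intro deriv_on_eqI)
     (auto intro!: derivative_eq_intros flat_has_vector_derivative simp: deriv_on_def)

lemma deriv_on_mult_t:
  assumes "f \<in> flat T"
  shows "deriv_on T (\<lambda>t. of_real t * f t) = (\<lambda>t. of_real t * deriv_on T f t + f t)"
  using assms
  by (intro deriv_on_eqI)
     (auto intro!: derivative_eq_intros flat_has_vector_derivative simp: deriv_on_def flat_outside)

lemma deriv_on_funpow_lincomb:
  assumes "f \<in> flat T" "g \<in> flat T"
  shows "(deriv_on T ^^ n) (\<lambda>t. a * f t + b * g t) =
    (\<lambda>t. a * (deriv_on T ^^ n) f t + b * (deriv_on T ^^ n) g t)"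
  by (induction n) (simp_all add: deriv_on_lincomb flat_deriv_on_funpow assms)

lemma deriv_on_funpow_mult_t:
  assumes "f \<in> flat T"
  shows "(deriv_on T ^^ Suc n) (\<lambda>t. of_real t * f t) =
    (\<lambda>t. of_real t * (deriv_on T ^^ Suc n) f t + of_nat (Suc n) * (deriv_on T ^^ n) f t)"
proof (induction n)
  case 0
  show ?case by (simp add: deriv_on_mult_t assms)
next
  case (Suc n)
  let ?g = "(deriv_on T ^^ Suc n) f"
  have "(deriv_on T ^^ Suc (Suc n)) (\<lambda>t. of_real t * f t) =
     deriv_on T (\<lambda>t. of_real t * ?g t + of_nat (Suc n) * (deriv_on T ^^ n) f t)"
    using Suc by (metis funpow.simps(2) o_apply)
  also have "\<dots> = deriv_on T (\<lambda>t. 1 * (of_real t * ?g t) + of_nat (Suc n) * (deriv_on T ^^ n) f t)"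
    by simp
  also have "\<dots> = (\<lambda>t. 1 * (of_real t * deriv_on T ?g t + ?g t) + of_nat (Suc n) * deriv_on T ((deriv_on T ^^ n) f) t)"
    by (subst deriv_on_lincomb) (simp_all only: deriv_on_mult_t flat_mult_t flat_deriv_on_funpow assms)
  finally show ?case by (simp add: algebra_simps)
qed

end

section \<open>Convolution of causal functions\<close>

definition conv :: "real \<Rightarrow> cfun \<Rightarrow> cfun \<Rightarrow> cfun" where
  "conv T k f = volterra T (\<lambda>t s. k (t - s)) f"

text \<open>
  These functions stay continuous when extended by zero to the negative half-line. This turns
  convolution, whose domain of integration depends on \<open>t\<close>, into an integral over the fixed interval
  \<open>{0..T}\<close>, to which Fubini's theorem and differentiation under the integral sign apply.
\<close>

definition causal :: "real \<Rightarrow> cfun set" where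
  "causal T = {k. continuous_on {..T} k \<and> (\<forall>t\<le>0. k t = 0) \<and> (\<forall>t>T. k t = 0)}"

context interval
begin

lemma causal_continuous: "k \<in> causal T \<Longrightarrow> continuous_on {..T} k"
  by (simp add: causal_def)

lemma causal_nonpos: "k \<in> causal T \<Longrightarrow> t \<le> 0 \<Longrightarrow> k t = 0"
  by (simp add: causal_def)

lemma causalI:
  assumes "continuous_on {0..T} k" "k 0 = 0" "\<And>t. t \<notin> {0..T} \<Longrightarrow> k t = 0"
  shows "k \<in> causal T"
proof -
  have zero: "k t = 0" if "t \<le> 0" for t
    using assms(2) assms(3)[of t] that by (cases "t = 0") auto
  have "continuous_on {..0} k"
    by (rule continuous_on_eq[of _ "\<lambda>t. 0"]) (auto simp: zero)
  then have "continuous_on ({..0} \<union> {0..T}) k"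
    using assms(1) by (intro continuous_on_closed_Un) auto
  moreover have "{..0} \<union> {0..T} = {..T}" using T_pos by auto
  ultimately show ?thesis using zero assms(3) by (auto simp: causal_def)
qed

lemma flat_causal: "f \<in> flat T \<Longrightarrow> f \<in> causal T"
  using flat_funpowD(1)[of f 0]
  by (intro causalI) (auto simp: flat_outside flat_0 differentiable_imp_continuous_on)

lemma causal_mult_t: "k \<in> causal T \<Longrightarrow> (\<lambda>t. of_real t * k t) \<in> causal T"
  by (auto simp: causal_def intro!: continuous_intros)

lemma causal_lincomb:
  "k \<in> causal T \<Longrightarrow> l \<in> causal T \<Longrightarrow> (\<lambda>t. a * k t + b * l t) \<in> causal T"
  by (auto simp: causal_def intro!: continuous_intros)

lemma continuous_on_conv_integrand:
  assumes "k \<in> causal T" "f \<in> causal T"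
  shows "continuous_on ({..T} \<times> {0..T}) (\<lambda>(t, s). k (t - s) * f s)"
  unfolding case_prod_unfold
  by (intro continuous_intros continuous_on_compose2[OF causal_continuous[OF assms(1)]]
        continuous_on_compose2[OF causal_continuous[OF assms(2)]]) auto

lemma conv_integrable:
  assumes "k \<in> causal T" "f \<in> causal T" "t \<le> T"
  shows "(\<lambda>s. k (t - s) * f s) integrable_on {0..T}"
  by (intro integrable_continuous_interval continuous_intros
      continuous_on_compose2[OF causal_continuous[OF assms(1)]]
      continuous_on_compose2[OF causal_continuous[OF assms(2)]]) (use assms(3) in auto)

lemma conv_eq_integral:
  assumes "k \<in> causal T" "t \<le> T"
  shows "conv T k f t = integral {0..T} (\<lambda>s. k (t - s) * f s)"
proof -
  have "integral {0..T} (\<lambda>s. k (t - s) * f s) =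
        integral {0..T} (\<lambda>s. if s \<in> {0..t} then k (t - s) * f s else 0)"
    using causal_nonpos[OF assms(1)] by (intro integral_cong) auto
  also have "\<dots> = integral ({0..T} \<inter> {0..t}) (\<lambda>s. k (t - s) * f s)"
    by (simp only: Henstock_Kurzweil_Integration.integral_restrict_Int Int_commute)
  also have "{0..T} \<inter> {0..t} = {0..t}" using assms(2) by auto
  finally show ?thesis using assms(2)
    by (cases "t \<ge> 0") (auto simp: conv_def volterra_def)
qed

lemma conv_outside: "t \<notin> {0..T} \<Longrightarrow> conv T k f t = 0"
  by (auto simp: conv_def volterra_def)

lemma conv_0: "conv T k f 0 = 0"
  by (auto simp: conv_def volterra_def)

lemma conv_causal:
  assumes "k \<in> causal T" "f \<in> causal T"
  shows "conv T k f \<in> causal T"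
proof (rule causalI)
  have "continuous_on {0..T} (\<lambda>t. integral (cbox 0 T) (\<lambda>s. k (t - s) * f s))"
    using continuous_on_conv_integrand[OF assms]
    by (intro integral_continuous_on_param) (auto elim: continuous_on_subset)
  then show "continuous_on {0..T} (conv T k f)"
    by (rule continuous_on_eq) (simp add: conv_eq_integral assms)
qed (simp_all add: conv_outside conv_0)

lemma integral_reflect_shift:
  fixes h :: "real \<Rightarrow> complex"
  shows "integral {0..t} (\<lambda>s. h (t - s)) = integral {0..t} h"
proof -
  have "integral {0..t} h = integral {-t..0} (\<lambda>s. h (- s))"
    using Henstock_Kurzweil_Integration.integral_reflect_real[of t 0 h] by simp
  also have "\<dots> = integral {0..t} ((\<lambda>s. h (- s)) \<circ> ((+) (- t)))"
    by (subst integral_shift_Icc_real) simp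
  finally show ?thesis by (simp add: o_def)
qed

lemma conv_commute: "conv T k f = conv T f k"
proof
  fix t
  have "integral {0..t} (\<lambda>s. k (t - s) * f s) = integral {0..t} (\<lambda>s. f (t - s) * k s)"
    using integral_reflect_shift[of t "\<lambda>s. f (t - s) * k s"] by (simp add: mult.commute)
  then show "conv T k f t = conv T f k t" by (simp add: conv_def volterra_def)
qed

text \<open>
  The inner integral that arises when the order of integration is exchanged in a double convolution.
\<close>

lemma integral_causal_shift:
  assumes "k \<in> causal T" "l \<in> causal T" "t \<in> {0..T}" "u \<in> {0..T}"
  shows "integral {0..T} (\<lambda>s. k (t - s) * l (s - u)) = conv T k l (t - u)"
proof (cases "u \<le> t")
  case True
  have "integral {0..T} (\<lambda>s. k (t - s) * l (s - u)) =
        integral {0..T} (\<lambda>s. if s \<in> {u..t} then k (t - s) * l (s - u) else 0)"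
    using causal_nonpos[OF assms(1)] causal_nonpos[OF assms(2)] by (intro integral_cong) auto
  also have "\<dots> = integral ({0..T} \<inter> {u..t}) (\<lambda>s. k (t - s) * l (s - u))"
    by (simp only: Henstock_Kurzweil_Integration.integral_restrict_Int Int_commute)
  also have "{0..T} \<inter> {u..t} = {0 + u..t - u + u}" using assms(3,4) by auto
  also have "integral \<dots> (\<lambda>s. k (t - s) * l (s - u)) =
        integral {0..t - u} ((\<lambda>s. k (t - s) * l (s - u)) \<circ> ((+) u))"
    by (rule integral_shift_Icc_real [symmetric])
  finally show ?thesis
    using True assms(3,4) by (simp add: o_def conv_def volterra_def algebra_simps)
next
  case False
  have "integral {0..T} (\<lambda>s. k (t - s) * l (s - u)) = integral {0..T} (\<lambda>s. 0)"
    using False causal_nonpos[OF assms(1)] causal_nonpos[OF assms(2)]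
    by (intro integral_cong) (auto, metis diff_ge_0_iff_ge le_cases minus_diff_eq neg_0_le_iff_le order_trans)
  then show ?thesis using False by (simp add: conv_outside)
qed

lemma conv_assoc:
  assumes "k \<in> causal T" "l \<in> causal T" "f \<in> causal T"
  shows "conv T k (conv T l f) = conv T (conv T k l) f"
proof
  fix t
  show "conv T k (conv T l f) t = conv T (conv T k l) f t"
  proof (cases "t \<in> {0..T}")
    case True
    have cont: "continuous_on (cbox (0, 0) (T, T)) (\<lambda>(s, u). k (t - s) * (l (s - u) * f u))"
      unfolding case_prod_unfold
      using True
      by (intro continuous_intros continuous_on_compose2[OF causal_continuous[OF assms(1)]]
        continuous_on_compose2[OF causal_continuous[OF assms(2)]]
        continuous_on_compose2[OF causal_continuous[OF assms(3)]]) (auto simp: cbox_Pair_eq)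
    have "conv T k (conv T l f) t = integral {0..T} (\<lambda>s. k (t - s) * conv T l f s)"
      using True assms by (simp add: conv_eq_integral)
    also have "\<dots> = integral {0..T} (\<lambda>s. integral {0..T} (\<lambda>u. k (t - s) * (l (s - u) * f u)))"
      using assms by (intro integral_cong) (simp add: conv_eq_integral)
    also have "\<dots> = integral {0..T} (\<lambda>u. integral {0..T} (\<lambda>s. k (t - s) * (l (s - u) * f u)))"
      using integral_swap_continuous[OF cont] by simp
    also have "\<dots> = integral {0..T} (\<lambda>u. integral {0..T} (\<lambda>s. k (t - s) * l (s - u)) * f u)"
      by (simp add: mult.assoc[symmetric])
    also have "\<dots> = integral {0..T} (\<lambda>u. conv T k l (t - u) * f u)"
      using True assms by (intro integral_cong) (simp only: integral_causal_shift)
    also have "\<dots> = conv T (conv T k l) f t"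
      using True assms by (simp add: conv_eq_integral conv_causal)
    finally show ?thesis .
  qed (simp add: conv_outside)
qed

lemma conv_lincomb_right:
  assumes "k \<in> causal T" "f \<in> causal T" "g \<in> causal T"
  shows "conv T k (\<lambda>t. a * f t + b * g t) = (\<lambda>t. a * conv T k f t + b * conv T k g t)"
proof
  fix t
  show "conv T k (\<lambda>t. a * f t + b * g t) t = a * conv T k f t + b * conv T k g t"
  proof (cases "t \<in> {0..T}")
    case True
    have I: "((\<lambda>s. k (t - s) * h s) has_integral conv T k h t) {0..T}" if "h \<in> causal T" for h
      using conv_integrable[OF assms(1) that, of t] True assms(1)
      by (simp add: conv_eq_integral integrable_integral)
    have "((\<lambda>s. a * (k (t - s) * f s) + b * (k (t - s) * g s)) has_integral
        (a * conv T k f t + b * conv T k g t)) {0..T}"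
      by (intro has_integral_add has_integral_mult_right I assms)
    then show ?thesis
      using True assms(1) by (simp add: conv_eq_integral integral_unique algebra_simps)
  qed (simp add: conv_outside)
qed

lemma conv_lincomb_left:
  assumes "k \<in> causal T" "f \<in> causal T" "g \<in> causal T"
  shows "conv T (\<lambda>t. a * f t + b * g t) k = (\<lambda>t. a * conv T f k t + b * conv T g k t)"
  using conv_lincomb_right[OF assms] by (simp add: conv_commute[of _ k])

lemma mult_t_conv:
  assumes "k \<in> causal T" "f \<in> causal T"
  shows "of_real t * conv T k f t = conv T (\<lambda>t. of_real t * k t) f t + conv T k (\<lambda>t. of_real t * f t) t"
proof (cases "t \<in> {0..T}")
  case True
  have I: "((\<lambda>s. k (t - s) * h s) has_integral conv T k h t) {0..T}"
    if "k \<in> causal T" "h \<in> causal T" for k h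
    using conv_integrable[OF that, of t] True that
    by (simp add: conv_eq_integral integrable_integral)
  have "((\<lambda>s. of_real (t - s) * k (t - s) * f s + k (t - s) * (of_real s * f s)) has_integral
     conv T (\<lambda>t. of_real t * k t) f t + conv T k (\<lambda>t. of_real t * f t) t) {0..T}"
    using I[OF causal_mult_t[OF assms(1)] assms(2)] I[OF assms(1) causal_mult_t[OF assms(2)]]
    by (intro has_integral_add)
  moreover have "((\<lambda>s. of_real t * (k (t - s) * f s)) has_integral of_real t * conv T k f t) {0..T}"
    by (intro has_integral_mult_right I assms)
  ultimately show ?thesis
    by (elim has_integral_unique[rotated]) (simp add: algebra_simps)
qed (simp add: conv_outside)

text \<open>
  Because a flat function and its derivative vanish at \<open>0\<close>, extending it by zero to the left keeps it
  differentiable; this is what differentiation of \<open>f (t - s)\<close> with respect to \<open>t\<close> needs when \<open>s > t\<close>.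
\<close>

lemma flat_has_vector_derivative_atMost:
  assumes "f \<in> flat T" "x \<le> T"
  shows "(f has_vector_derivative deriv_on T f x) (at x within {..T})"
proof -
  have left: "(f has_vector_derivative deriv_on T f x) (at x within {..0})"
  proof (cases "x \<le> 0")
    case True
    have z: "g y = 0" if "y \<le> 0" "g \<in> flat T" for y g
      using causal_nonpos[OF flat_causal] that by blast
    have "((\<lambda>x. 0) has_vector_derivative 0) (at x within {..0})" by simp
    then have "(f has_vector_derivative 0) (at x within {..0})"
      by (rule has_vector_derivative_transform[rotated 2]) (use True z[OF _ assms(1)] in auto)
    then show ?thesis using z[OF True flat_deriv_on[OF assms(1)]] by simp
  next
    case False
    then have "at x within {..0} = bot"
      by (intro not_in_closure_trivial_limitI) simp
    then show ?thesis by (simp add: has_vector_derivative_def has_derivative_def bounded_linear_scaleR_left)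
  qed
  have right: "(f has_vector_derivative deriv_on T f x) (at x within {0..T})"
  proof (cases "x \<ge> 0")
    case True
    then show ?thesis using assms by (intro flat_has_vector_derivative) auto
  next
    case False
    then have "at x within {0..T} = bot"
      by (intro not_in_closure_trivial_limitI) simp
    then show ?thesis by (simp add: has_vector_derivative_def has_derivative_def bounded_linear_scaleR_left)
  qed
  have "{..T} = {..0} \<union> {0..T}" using T_pos by auto
  then show ?thesis
    using left right unfolding has_vector_derivative_def has_derivative_within
    by (auto simp: at_within_union intro: filterlim_sup)
qed

text \<open>
  Differentiation under the integral sign, with the derivative placed on the flat factor; no boundary
  term appears since that factor vanishes at \<open>0\<close>.
\<close>

lemma conv_has_vector_derivative:
  assumes "k \<in> causal T" "f \<in> flat T" "t \<in> {0..T}"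
  shows "(conv T k f has_vector_derivative conv T k (deriv_on T f) t) (at t within {0..T})"
proof -
  note fc = flat_causal[OF assms(2)] and dc = flat_causal[OF flat_deriv_on[OF assms(2)]]
  have chain: "((\<lambda>t. f (t - s)) has_vector_derivative deriv_on T f (x - s)) (at x within {0..T})"
    if "x \<in> {0..T}" "s \<in> {0..T}" for x s
  proof -
    have "((\<lambda>t. t - s) has_vector_derivative 1) (at x within {0..T})"
      by (auto intro!: derivative_eq_intros)
    moreover have "(f has_vector_derivative deriv_on T f (x - s)) (at (x - s) within (\<lambda>t. t - s) ` {0..T})"
      using that
      by (intro has_vector_derivative_within_subset[OF flat_has_vector_derivative_atMost[OF assms(2)]]) auto
    ultimately show ?thesis
      using vector_diff_chain_within[of "\<lambda>t. t - s" 1 x "{0..T}" f "deriv_on T f (x - s)"]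
      by (simp add: o_def)
  qed
  have "((\<lambda>t. integral (cbox 0 T) (\<lambda>s. f (t - s) * k s)) has_vector_derivative
      integral (cbox 0 T) (\<lambda>s. deriv_on T f (t - s) * k s)) (at t within {0..T})"
  proof (rule leibniz_rule_vector_derivative)
    show "((\<lambda>x. f (x - s) * k s) has_vector_derivative deriv_on T f (x - s) * k s) (at x within {0..T})"
      if "x \<in> {0..T}" "s \<in> cbox 0 T" for x s
      using chain[of x s] that by (auto intro!: derivative_eq_intros)
    show "(\<lambda>s. f (x - s) * k s) integrable_on cbox 0 T" if "x \<in> {0..T}" for x
      using conv_integrable[OF fc assms(1)] that by simp
    show "continuous_on ({0..T} \<times> cbox 0 T) (\<lambda>(x, s). deriv_on T f (x - s) * k s)"
      using continuous_on_conv_integrand[OF dc assms(1)] by (auto elim: continuous_on_subset)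
  qed (use assms(3) in auto)
  then have "((\<lambda>t. integral {0..T} (\<lambda>s. f (t - s) * k s)) has_vector_derivative
      conv T (deriv_on T f) k t) (at t within {0..T})"
    using assms(3) by (simp add: conv_eq_integral dc)
  then have "(conv T f k has_vector_derivative conv T (deriv_on T f) k t) (at t within {0..T})"
    by (rule has_vector_derivative_transform[rotated 2])
       (use assms(3) in \<open>auto simp: conv_eq_integral fc\<close>)
  then show ?thesis by (simp add: conv_commute)
qed

lemma conv_flat:
  assumes "k \<in> causal T" "f \<in> flat T"
  shows "conv T k f \<in> flat T"
proof -
  have "conv T k f \<in> conv T k ` flat T" using assms(2) by blast
  then show ?thesis
  proof (coinduct rule: flat_coinduct)
    case (deriv h)
    then obtain g where "h = conv T k g" "g \<in> flat T" by blast
    then show ?case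
      using conv_has_vector_derivative[OF assms(1)]
      by (intro bexI[of _ "conv T k (deriv_on T g)"]) (auto intro: flat_deriv_on)
  qed (auto simp: conv_outside conv_0)
qed

lemma deriv_on_conv:
  assumes "k \<in> causal T" "f \<in> flat T"
  shows "deriv_on T (conv T k f) = conv T k (deriv_on T f)"
  by (intro deriv_on_eqI conv_has_vector_derivative assms conv_outside)

lemma deriv_on_funpow_conv:
  assumes "k \<in> causal T" "f \<in> flat T"
  shows "(deriv_on T ^^ n) (conv T k f) = conv T k ((deriv_on T ^^ n) f)"
  by (induction n) (simp_all add: deriv_on_conv flat_deriv_on_funpow assms)

end

section \<open>Fractional calculus on flat functions\<close>

text \<open>
  The convolution kernel of \<open>J\<^sup>\<mu>\<close>, singular at \<open>0\<close> for \<open>0 < \<mu> < 1\<close>.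
\<close>

definition frac_kernel :: "real \<Rightarrow> real \<Rightarrow> cfun" where
  "frac_kernel T \<mu> t = (if t \<in> {0..T} then of_real (t powr (\<mu> - 1) / Gamma \<mu>) else 0)"

lemma Gamma_real_nonzero: "\<mu> > 0 \<Longrightarrow> Gamma (\<mu> :: real) \<noteq> 0"
  by (metis Gamma_real_pos less_irrefl)

lemma Gamma_real_plus1: "\<mu> > 0 \<Longrightarrow> Gamma (\<mu> + 1 :: real) = \<mu> * Gamma \<mu>"
  by (rule Gamma_plus1) (auto elim: nonpos_Ints_cases)

context interval
begin

lemma frac_kernel_causal:
  assumes "\<mu> > 1" shows "frac_kernel T \<mu> \<in> causal T"
proof (rule causalI)
  have "continuous_on {0..T} (\<lambda>t. t powr (\<mu> - 1))"
    by (rule continuous_on_powr') (use assms in \<open>auto intro!: continuous_intros\<close>)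
  moreover have "Gamma \<mu> \<noteq> 0" using Gamma_real_nonzero[of \<mu>] assms by simp
  ultimately have "continuous_on {0..T} (\<lambda>t. complex_of_real (t powr (\<mu> - 1) / Gamma \<mu>))"
    by (intro continuous_on_of_real continuous_on_divide continuous_on_const) auto
  then show "continuous_on {0..T} (frac_kernel T \<mu>)"
    by (rule continuous_on_eq) (simp add: frac_kernel_def)
qed (use T_pos in \<open>auto simp: frac_kernel_def\<close>)

lemma frac_int_eq_conv: "frac_int T \<mu> f = conv T (frac_kernel T \<mu>) f"
proof
  fix t
  have "of_real (1 / Gamma \<mu>) * integral {0..t} (\<lambda>s. of_real ((t - s) powr (\<mu> - 1)) * f s) =
    integral {0..t} (\<lambda>s. frac_kernel T \<mu> (t - s) * f s)" if "t \<in> {0..T}"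
  proof -
    have "of_real (1 / Gamma \<mu>) * integral {0..t} (\<lambda>s. of_real ((t - s) powr (\<mu> - 1)) * f s) =
      integral {0..t} (\<lambda>s. of_real (1 / Gamma \<mu>) * (of_real ((t - s) powr (\<mu> - 1)) * f s))"
      by simp
    also have "\<dots> = integral {0..t} (\<lambda>s. frac_kernel T \<mu> (t - s) * f s)"
      using that by (intro integral_cong) (auto simp: frac_kernel_def)
    finally show ?thesis .
  qed
  then show "frac_int T \<mu> f t = conv T (frac_kernel T \<mu>) f t"
    by (simp add: frac_int_def conv_def volterra_def)
qed

text \<open>
  The Beta integral transported from \<open>{0..1}\<close> to \<open>{0..t}\<close> by the substitution \<open>s = t x\<close>.
\<close>

lemma Beta_integral_scaled:
  fixes a b t :: real
  assumes "a > 0" "b > 0" "t > 0"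
  shows "((\<lambda>s. (t - s) powr (a - 1) * s powr (b - 1)) has_integral
     t powr (a + b - 1) * (Gamma a * Gamma b / Gamma (a + b))) {0..t}"
proof -
  have img: "(\<lambda>x. x / (1 / t)) ` {0..1} = {0..t}"
    using assms(3) image_affinity_atLeastAtMost[of t 0 0 1] by (simp add: mult.commute)
  have "((\<lambda>s. (1 / t * s) powr (b - 1) * (1 - 1 / t * s) powr (a - 1)) has_integral
      (1 / \<bar>1 / t\<bar>) *\<^sub>R Beta b a) {0..t}"
    using has_integral_stretch_real[OF has_integral_Beta_real[OF assms(2,1)], of "1 / t"] assms(3)
    unfolding img by simp
  then have "((\<lambda>s. t powr (a + b - 2) * ((1 / t * s) powr (b - 1) * (1 - 1 / t * s) powr (a - 1))) has_integral
      t powr (a + b - 2) * ((1 / \<bar>1 / t\<bar>) *\<^sub>R Beta b a)) {0..t}"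
    by (intro has_integral_mult_right)
  moreover have "t powr (a + b - 2) * ((1 / t * s) powr (b - 1) * (1 - 1 / t * s) powr (a - 1)) =
      (t - s) powr (a - 1) * s powr (b - 1)" if "s \<in> {0..t}" for s
  proof -
    have 1: "t powr (a + b - 2) = t powr (b - 1) * t powr (a - 1)"
      by (simp add: powr_add[symmetric] add.commute)
    have 2: "t powr (b - 1) * (1 / t * s) powr (b - 1) = s powr (b - 1)"
      using that assms(3) by (subst powr_mult[symmetric]) auto
    have "t * (1 - 1 / t * s) = t - s"
      using assms(3) by (simp add: right_diff_distrib)
    then have 3: "t powr (a - 1) * (1 - 1 / t * s) powr (a - 1) = (t - s) powr (a - 1)"
      by (metis powr_mult)
    have "t powr (a + b - 2) * ((1 / t * s) powr (b - 1) * (1 - 1 / t * s) powr (a - 1)) =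
       (t powr (a - 1) * (1 - 1 / t * s) powr (a - 1)) * (t powr (b - 1) * (1 / t * s) powr (b - 1))"
      unfolding 1 by (simp only: mult_ac)
    then show ?thesis unfolding 2 3 .
  qed
  moreover have "t powr (a + b - 2) * ((1 / \<bar>1 / t\<bar>) *\<^sub>R Beta b a) =
      t powr (a + b - 1) * (Gamma a * Gamma b / Gamma (a + b))"
    using assms(3) powr_mult_base[of t "a + b - 2"]
    by (simp add: Beta_def algebra_simps)
  ultimately show ?thesis
    by (metis (no_types, lifting) has_integral_cong)
qed

lemma frac_kernel_semigroup:
  assumes "a > 1" "b > 1"
  shows "conv T (frac_kernel T a) (frac_kernel T b) = frac_kernel T (a + b)"
proof
  fix t
  show "conv T (frac_kernel T a) (frac_kernel T b) t = frac_kernel T (a + b) t"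
  proof (cases "0 < t \<and> t \<le> T")
    case True
    have "((\<lambda>s. complex_of_real ((t - s) powr (a - 1) * s powr (b - 1))) has_integral
       of_real (t powr (a + b - 1) * (Gamma a * Gamma b / Gamma (a + b)))) {0..t}"
      using has_integral_linear[OF Beta_integral_scaled bounded_linear_of_real, of a b t] assms True
      by (simp add: o_def del: of_real_mult of_real_divide)
    then have "((\<lambda>s. of_real (1 / (Gamma a * Gamma b)) * complex_of_real ((t - s) powr (a - 1) * s powr (b - 1)))
       has_integral of_real (1 / (Gamma a * Gamma b)) *
         of_real (t powr (a + b - 1) * (Gamma a * Gamma b / Gamma (a + b)))) {0..t}"
      by (rule has_integral_mult_right)
    moreover have "of_real (1 / (Gamma a * Gamma b)) *
         complex_of_real (t powr (a + b - 1) * (Gamma a * Gamma b / Gamma (a + b))) = frac_kernel T (a + b) t"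
      using True Gamma_real_nonzero[of a] Gamma_real_nonzero[of b] assms by (simp add: frac_kernel_def)
    moreover have "of_real (1 / (Gamma a * Gamma b)) * complex_of_real ((t - s) powr (a - 1) * s powr (b - 1)) =
        frac_kernel T a (t - s) * frac_kernel T b s" if "s \<in> {0..t}" for s
      using True that by (simp add: frac_kernel_def)
    ultimately have "((\<lambda>s. frac_kernel T a (t - s) * frac_kernel T b s) has_integral frac_kernel T (a + b) t) {0..t}"
      by (metis (no_types, lifting) has_integral_cong)
    then show ?thesis
      using True by (simp add: conv_def volterra_def integral_unique)
  next
    case False
    then have "frac_kernel T (a + b) t = 0" "conv T (frac_kernel T a) (frac_kernel T b) t = 0"
      by (auto simp: frac_kernel_def conv_def volterra_def le_less)
    then show ?thesis by simp
  qed
qed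

lemma mult_t_frac_kernel:
  assumes "\<mu> > 0"
  shows "of_real t * frac_kernel T \<mu> t = of_real \<mu> * frac_kernel T (\<mu> + 1) t"
proof -
  have "Gamma (\<mu> + 1) = \<mu> * Gamma \<mu>"
    using assms by (rule Gamma_real_plus1)
  then have "t * (t powr (\<mu> - 1) / Gamma \<mu>) = \<mu> * (t powr \<mu> / Gamma (\<mu> + 1))" if "t \<ge> 0"
    using assms that powr_mult_base[of t "\<mu> - 1"] by simp
  then show ?thesis
    unfolding frac_kernel_def by (auto simp flip: of_real_mult simp del: of_real_divide)
qed

lemma frac_kernel_has_vector_derivative:
  assumes "\<mu> > 0" "0 < x" "x < T"
  shows "(frac_kernel T (\<mu> + 1) has_vector_derivative frac_kernel T \<mu> x) (at x)"
proof -
  have G: "Gamma (\<mu> + 1) = \<mu> * Gamma \<mu>"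
    using assms(1) by (rule Gamma_real_plus1)
  have "((\<lambda>x. x powr \<mu> / Gamma (\<mu> + 1)) has_real_derivative x powr (\<mu> - 1) / Gamma \<mu>) (at x)"
    using assms(1,2) Gamma_real_nonzero[OF assms(1)] unfolding G
    by (auto intro!: derivative_eq_intros)
  then have "((\<lambda>x. complex_of_real (x powr \<mu> / Gamma (\<mu> + 1))) has_vector_derivative
      of_real (x powr (\<mu> - 1) / Gamma \<mu>)) (at x)"
    by (intro has_vector_derivative_of_real) (simp add: has_real_derivative_iff_has_vector_derivative)
  moreover have "of_real (x powr (\<mu> - 1) / Gamma \<mu>) = frac_kernel T \<mu> x"
    using assms by (simp add: frac_kernel_def)
  ultimately show ?thesis
    by (simp only:, elim has_vector_derivative_transform_within_open[of _ _ _ "{0<..<T}"])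
       (use assms in \<open>auto simp: frac_kernel_def\<close>)
qed

text \<open>
  Integration by parts: \<open>J\<^sup>\<mu> f = J\<^sup>\<mu>\<^sup>+\<^sup>1 f'\<close>. For \<open>\<mu> < 1\<close> the integrand on the left is singular at
  \<open>s = t\<close>, but the antiderivative used is continuous there and vanishes at both ends, so the fundamental
  theorem for gauge integrals applies without any separate treatment of the singularity.
\<close>

lemma conv_frac_kernel_shift:
  assumes "\<mu> > 0" "f \<in> flat T"
  shows "conv T (frac_kernel T \<mu>) f = conv T (frac_kernel T (\<mu> + 1)) (deriv_on T f)"
proof
  fix t
  show "conv T (frac_kernel T \<mu>) f t = conv T (frac_kernel T (\<mu> + 1)) (deriv_on T f) t"
  proof (cases "t \<in> {0..T}")
    case True
    let ?F = "\<lambda>s. - (frac_kernel T (\<mu> + 1) (t - s) * f s)"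
    let ?G = "\<lambda>s. frac_kernel T (\<mu> + 1) (t - s) * deriv_on T f s"
    have pc: "frac_kernel T (\<mu> + 1) \<in> causal T" using assms(1) by (intro frac_kernel_causal) simp
    note cont = continuous_on_compose2[OF causal_continuous[OF pc]]
      continuous_on_compose2[OF causal_continuous[OF flat_causal[OF assms(2)]]]
      continuous_on_compose2[OF causal_continuous[OF flat_causal[OF flat_deriv_on[OF assms(2)]]]]
    have "((\<lambda>s. frac_kernel T \<mu> (t - s) * f s - ?G s) has_integral ?F t - ?F 0) {0..t}"
    proof (rule fundamental_theorem_of_calculus_interior)
      show "0 \<le> t" using True by simp
      show "continuous_on {0..t} ?F"
        using True by (intro continuous_intros cont) auto
      fix s assume s: "s \<in> {0<..<t}"
      have "((\<lambda>s. t - s) has_vector_derivative -1) (at s)"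
        by (auto intro!: derivative_eq_intros)
      moreover have "(frac_kernel T (\<mu> + 1) has_vector_derivative frac_kernel T \<mu> (t - s)) (at (t - s))"
        using s True assms(1) by (intro frac_kernel_has_vector_derivative) auto
      ultimately have 1: "((\<lambda>s. frac_kernel T (\<mu> + 1) (t - s)) has_vector_derivative - frac_kernel T \<mu> (t - s)) (at s)"
        using vector_diff_chain_at[of "\<lambda>s. t - s" "-1" s "frac_kernel T (\<mu> + 1)" "frac_kernel T \<mu> (t - s)"]
        by (simp add: o_def)
      have "(f has_vector_derivative deriv_on T f s) (at s within {0..T})"
        using s True assms(2) by (intro flat_has_vector_derivative) auto
      moreover have "at s within {0..T} = at s"
        using s True by (intro at_within_interior) auto
      ultimately have 2: "(f has_vector_derivative deriv_on T f s) (at s)" by simp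
      show "(?F has_vector_derivative frac_kernel T \<mu> (t - s) * f s - ?G s) (at s)"
        by (auto intro!: derivative_eq_intros 1 2)
    qed
    moreover have "?F t - ?F 0 = 0"
      using causal_nonpos[OF pc, of 0] flat_0[OF assms(2)] by simp
    moreover have "?G integrable_on {0..t}"
      using True by (intro integrable_continuous_interval continuous_intros cont) auto
    ultimately have "((\<lambda>s. frac_kernel T \<mu> (t - s) * f s - ?G s + ?G s) has_integral 0 + integral {0..t} ?G) {0..t}"
      by (intro has_integral_add) (auto simp: integrable_integral)
    then show ?thesis
      using True by (auto simp: conv_def volterra_def intro!: integral_unique)
  qed (simp add: conv_outside)
qed

lemma conv_frac_kernel_1:
  assumes "f \<in> flat T"
  shows "conv T (frac_kernel T 1) (deriv_on T f) = f"
proof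
  fix t
  show "conv T (frac_kernel T 1) (deriv_on T f) t = f t"
  proof (cases "t \<in> {0..T}")
    case True
    have "(deriv_on T f has_integral f t - f 0) {0..t}"
      using True assms
      by (intro fundamental_theorem_of_calculus
          has_vector_derivative_within_subset[OF flat_has_vector_derivative]) auto
    then have "((\<lambda>s. frac_kernel T 1 (t - s) * deriv_on T f s) has_integral f t - f 0) {0..t}"
      by (rule has_integral_spike_finite[rotated 2, of _ _ _ "{t}"]) (use True in \<open>auto simp: frac_kernel_def\<close>)
    then show ?thesis
      using True flat_0[OF assms] by (simp add: conv_def volterra_def integral_unique)
  qed (simp add: conv_outside flat_outside assms)
qed

lemma conv_frac_kernel_shift_funpow:
  assumes "\<mu> > 0" "f \<in> flat T"
  shows "conv T (frac_kernel T \<mu>) f = conv T (frac_kernel T (\<mu> + real n)) ((deriv_on T ^^ n) f)"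
proof (induction n)
  case (Suc n)
  then show ?case
    using conv_frac_kernel_shift[of "\<mu> + real n" "(deriv_on T ^^ n) f"] assms
    by (simp add: flat_deriv_on_funpow add_ac)
qed simp

text \<open>
  All branches in the definition of the fractional derivative are instances of one formula, in which the
  integer \<open>n\<close> is at our disposal. Taking \<open>n > \<alpha> + 1\<close> makes the kernel causal.
\<close>

lemma frac_deriv_eq_conv:
  assumes "real n > \<alpha>" "f \<in> flat T"
  shows "frac_deriv T \<alpha> f = conv T (frac_kernel T (real n - \<alpha>)) ((deriv_on T ^^ n) f)"
proof -
  consider "\<alpha> < 0" | "\<alpha> = 0" | "\<alpha> > 0" by linarith
  then show ?thesis
  proof cases
    case 1
    then show ?thesis
      using conv_frac_kernel_shift_funpow[of "-\<alpha>" f n] assms(2)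
      by (simp add: frac_deriv_def frac_int_eq_conv)
  next
    case 2
    then obtain m where n: "n = Suc m" using assms(1) by (cases n) auto
    show ?thesis
      using conv_frac_kernel_1[OF assms(2)] conv_frac_kernel_shift_funpow[of 1 "deriv_on T f" m] flat_deriv_on[OF assms(2)] 2
      by (simp add: frac_deriv_def n funpow_Suc_right del: funpow.simps)
  next
    case 3
    define m where "m = nat (\<lfloor>\<alpha>\<rfloor> + 1)"
    have m: "real m > \<alpha>" "m \<le> n"
      using 3 assms(1) unfolding m_def by linarith+
    then obtain d where d: "n = d + m" by (metis le_add_diff_inverse2)
    have "frac_deriv T \<alpha> f = conv T (frac_kernel T (real m - \<alpha>)) ((deriv_on T ^^ m) f)"
      using 3 by (simp add: frac_deriv_def frac_int_eq_conv m_def Let_def)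
    also have "\<dots> = conv T (frac_kernel T (real m - \<alpha> + real d)) ((deriv_on T ^^ d) ((deriv_on T ^^ m) f))"
      using m(1) assms(2) by (intro conv_frac_kernel_shift_funpow flat_deriv_on_funpow) auto
    also have "\<dots> = conv T (frac_kernel T (real n - \<alpha>)) ((deriv_on T ^^ n) f)"
      by (simp add: d funpow_add algebra_simps)
    finally show ?thesis .
  qed
qed

lemma frac_deriv_flat:
  assumes "f \<in> flat T" shows "frac_deriv T \<alpha> f \<in> flat T"
proof -
  obtain n :: nat where n: "real n > \<alpha> + 1" using reals_Archimedean2 by blast
  show ?thesis
    using n assms by (subst frac_deriv_eq_conv[of _ n])
       (auto intro!: conv_flat frac_kernel_causal flat_deriv_on_funpow)
qed

lemma frac_deriv_lincomb:
  assumes "f \<in> flat T" "g \<in> flat T"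
  shows "frac_deriv T \<alpha> (\<lambda>t. a * f t + b * g t) =
    (\<lambda>t. a * frac_deriv T \<alpha> f t + b * frac_deriv T \<alpha> g t)"
proof -
  obtain n :: nat where n: "real n > \<alpha> + 1" using reals_Archimedean2 by blast
  have "frac_deriv T \<alpha> h = conv T (frac_kernel T (real n - \<alpha>)) ((deriv_on T ^^ n) h)" if "h \<in> flat T" for h
    using n that by (intro frac_deriv_eq_conv) auto
  then show ?thesis
    using n assms
    by (simp add: flat_lincomb deriv_on_funpow_lincomb conv_lincomb_right frac_kernel_causal flat_causal
        flat_deriv_on_funpow)
qed

text \<open>
  With both operators in the form of convolutions, the integer derivatives move to the innermost function
  and the two kernels combine by the semigroup law.
\<close>

lemma frac_deriv_frac_deriv:
  assumes "f \<in> flat T"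
  shows "frac_deriv T \<alpha> (frac_deriv T \<beta> f) = frac_deriv T (\<alpha> + \<beta>) f"
proof -
  obtain n :: nat where n: "real n > \<alpha> + 1" using reals_Archimedean2 by blast
  obtain m :: nat where m: "real m > \<beta> + 1" using reals_Archimedean2 by blast
  let ?k = "frac_kernel T (real n - \<alpha>)" and ?l = "frac_kernel T (real m - \<beta>)" and ?g = "(deriv_on T ^^ (n + m)) f"
  have kl: "?k \<in> causal T" "?l \<in> causal T" "?g \<in> causal T"
    using n m assms by (simp_all add: frac_kernel_causal flat_causal flat_deriv_on_funpow)
  have "frac_deriv T \<alpha> (frac_deriv T \<beta> f) =
      conv T ?k ((deriv_on T ^^ n) (conv T ?l ((deriv_on T ^^ m) f)))"
    using n m frac_deriv_flat[OF assms, of \<beta>] assms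
    by (simp add: frac_deriv_eq_conv[of _ n] frac_deriv_eq_conv[of _ m])
  also have "\<dots> = conv T ?k (conv T ?l ?g)"
    using kl assms by (simp add: deriv_on_funpow_conv flat_deriv_on_funpow funpow_add)
  also have "\<dots> = conv T (conv T ?k ?l) ?g"
    using kl by (rule conv_assoc)
  also have "conv T ?k ?l = frac_kernel T (real (n + m) - (\<alpha> + \<beta>))"
    using n m by (subst frac_kernel_semigroup) (auto simp: algebra_simps)
  also have "conv T \<dots> ?g = frac_deriv T (\<alpha> + \<beta>) f"
    using n m assms by (intro frac_deriv_eq_conv[symmetric]) auto
  finally show ?thesis .
qed

lemma frac_deriv_conv:
  assumes "k \<in> causal T" "f \<in> flat T"
  shows "frac_deriv T \<alpha> (conv T k f) = conv T k (frac_deriv T \<alpha> f)"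
proof -
  obtain n :: nat where n: "real n > \<alpha> + 1" using reals_Archimedean2 by blast
  let ?l = "frac_kernel T (real n - \<alpha>)" and ?g = "(deriv_on T ^^ n) f"
  have l: "?l \<in> causal T" and g: "?g \<in> causal T"
    using n assms(2) by (simp_all add: frac_kernel_causal flat_causal flat_deriv_on_funpow)
  have "frac_deriv T \<alpha> (conv T k f) = conv T ?l (conv T k ?g)"
    using n assms by (simp add: frac_deriv_eq_conv[of _ n] conv_flat deriv_on_funpow_conv)
  also have "\<dots> = conv T (conv T k ?l) ?g"
    using conv_assoc[OF l assms(1) g] by (simp add: conv_commute[of _ ?l])
  also have "\<dots> = conv T k (conv T ?l ?g)"
    using conv_assoc[OF assms(1) l g] by simp
  also have "conv T ?l ?g = frac_deriv T \<alpha> f"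
    using n assms by (intro frac_deriv_eq_conv[symmetric]) auto
  finally show ?thesis .
qed

text \<open>
  The Leibniz rule gives \<open>n D\<^sup>\<alpha>\<^sup>-\<^sup>1\<close> from the \<open>n\<close> integer derivatives, and moving \<open>t\<close> across the
  kernel of \<open>J\<^sup>n\<^sup>-\<^sup>\<alpha>\<close> subtracts \<open>(n - \<alpha>) D\<^sup>\<alpha>\<^sup>-\<^sup>1\<close>; the difference is \<open>\<alpha> D\<^sup>\<alpha>\<^sup>-\<^sup>1\<close>.
\<close>

lemma frac_deriv_mult_t:
  assumes "f \<in> flat T"
  shows "frac_deriv T \<alpha> (\<lambda>t. of_real t * f t) =
    (\<lambda>t. of_real t * frac_deriv T \<alpha> f t + of_real \<alpha> * frac_deriv T (\<alpha> - 1) f t)"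
proof
  fix t
  obtain n :: nat where n: "real n > \<bar>\<alpha>\<bar> + 1" using reals_Archimedean2 by blast
  then obtain m where m: "n = Suc m" by (cases n) auto
  define \<mu> where "\<mu> = real n - \<alpha>"
  define g h where "g = (deriv_on T ^^ n) f" and "h = (deriv_on T ^^ m) f"
  have \<mu>: "\<mu> > 1" using n by (simp add: \<mu>_def)
  have pc: "frac_kernel T \<mu> \<in> causal T" "frac_kernel T (\<mu> + 1) \<in> causal T"
    using \<mu> by (auto intro!: frac_kernel_causal)
  have gh: "g \<in> flat T" "h \<in> flat T"
    using assms by (simp_all add: g_def h_def flat_deriv_on_funpow)
  have D0: "frac_deriv T \<alpha> u = conv T (frac_kernel T \<mu>) ((deriv_on T ^^ n) u)" if "u \<in> flat T" for u
    unfolding \<mu>_def using n that by (intro frac_deriv_eq_conv) auto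
  \<comment> \<open>The term \<open>D\<^sup>\<alpha>\<^sup>-\<^sup>1 f\<close> arises in two shapes, with \<open>n\<close> and with \<open>n - 1\<close> integer derivatives.\<close>
  have D1: "frac_deriv T (\<alpha> - 1) f = conv T (frac_kernel T (\<mu> + 1)) g"
    unfolding \<mu>_def g_def using n assms frac_deriv_eq_conv[of "\<alpha> - 1" n f] by (simp add: algebra_simps)
  have D2: "frac_deriv T (\<alpha> - 1) f = conv T (frac_kernel T \<mu>) h"
    unfolding \<mu>_def h_def using n assms frac_deriv_eq_conv[of "\<alpha> - 1" m f] by (simp add: m algebra_simps)
  have "frac_deriv T \<alpha> (\<lambda>t. of_real t * f t) t =
      conv T (frac_kernel T \<mu>) (\<lambda>t. 1 * (of_real t * g t) + of_nat n * h t) t"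
    using deriv_on_funpow_mult_t[OF assms, of m]
    by (simp add: D0 flat_mult_t assms g_def h_def m del: funpow.simps)
  also have "\<dots> = conv T (frac_kernel T \<mu>) (\<lambda>t. of_real t * g t) t + of_nat n * conv T (frac_kernel T \<mu>) h t"
    using gh pc by (subst conv_lincomb_right) (auto intro: flat_causal flat_mult_t)
  also have "conv T (frac_kernel T \<mu>) (\<lambda>t. of_real t * g t) t =
      of_real t * conv T (frac_kernel T \<mu>) g t - conv T (\<lambda>t. of_real \<mu> * frac_kernel T (\<mu> + 1) t + 0 * frac_kernel T \<mu> t) g t"
    using mult_t_conv[OF pc(1) flat_causal[OF gh(1)], of t] \<mu> by (simp add: mult_t_frac_kernel)
  also have "conv T (\<lambda>t. of_real \<mu> * frac_kernel T (\<mu> + 1) t + 0 * frac_kernel T \<mu> t) g t = of_real \<mu> * conv T (frac_kernel T (\<mu> + 1)) g t"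
    using gh pc by (subst conv_lincomb_left) (auto intro: flat_causal)
  finally have "frac_deriv T \<alpha> (\<lambda>t. of_real t * f t) t =
      of_real t * frac_deriv T \<alpha> f t + (of_nat n - of_real \<mu>) * frac_deriv T (\<alpha> - 1) f t"
    using D0[OF assms] D1 D2 by (simp add: g_def algebra_simps)
  then show "frac_deriv T \<alpha> (\<lambda>t. of_real t * f t) t =
      of_real t * frac_deriv T \<alpha> f t + of_real \<alpha> * frac_deriv T (\<alpha> - 1) f t"
    by (simp add: \<mu>_def)
qed

end

section \<open>Recovering a causal kernel from its action on flat functions\<close>

lemma poly_times_exp_tendsto_0:
  fixes p :: "real poly"
  shows "((\<lambda>x. x ^ k * poly p x / exp x) \<longlongrightarrow> 0) at_top"
proof (induction p arbitrary: k)
  case (pCons a p)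
  have "((\<lambda>x. a * (x ^ k / exp x) + x ^ Suc k * poly p x / exp x) \<longlongrightarrow> a * 0 + 0) at_top"
    by (intro tendsto_add tendsto_mult tendsto_const tendsto_power_div_exp_0 pCons.IH)
  moreover have "(\<lambda>x. x ^ k * poly (pCons a p) x / exp x) =
      (\<lambda>x. a * (x ^ k / exp x) + x ^ Suc k * poly p x / exp x)"
    by (simp add: fun_eq_iff algebra_simps add_divide_distrib)
  ultimately show ?case by simp
qed simp

text \<open>
  The functions \<open>p(1/t) exp(-1/t)\<close>, extended by zero. The polynomial factor makes the family closed under
  differentiation, the derivative having the factor \<open>x\<^sup>2 (p - p')\<close> at \<open>x = 1/t\<close>; only \<open>p = 1\<close> is used as
  a test function.
\<close>

definition flat_exp :: "real \<Rightarrow> real poly \<Rightarrow> real \<Rightarrow> real" where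
  "flat_exp T p t = (if 0 < t \<and> t \<le> T then poly p (1 / t) * exp (- (1 / t)) else 0)"

context interval
begin

lemma flat_exp_has_derivative:
  assumes "t \<in> {0..T}"
  shows "(flat_exp T p has_real_derivative flat_exp T ([:0, 0, 1:] * (p - pderiv p)) t) (at t within {0..T})"
proof (cases "t = 0")
  case True
  have "((\<lambda>x. x ^ 1 * poly p x / exp x) \<longlongrightarrow> 0) at_top"
    by (rule poly_times_exp_tendsto_0)
  then have "((\<lambda>t. inverse t ^ 1 * poly p (inverse t) / exp (inverse t)) \<longlongrightarrow> 0) (at_right 0)"
    by (rule filterlim_compose[OF _ filterlim_inverse_at_top_right])
  then have "((\<lambda>t. flat_exp T p t / t) \<longlongrightarrow> 0) (at_right 0)"
  proof (rule Lim_transform_eventually)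
    show "\<forall>\<^sub>F t in at_right 0. inverse t ^ 1 * poly p (inverse t) / exp (inverse t) = flat_exp T p t / t"
      using eventually_at_right_real[OF T_pos]
      by eventually_elim (simp add: flat_exp_def exp_minus field_simps)
  qed
  then have "((\<lambda>t. flat_exp T p t / t) \<longlongrightarrow> 0) (at 0 within {0..T})"
    using T_pos by (simp add: at_within_Icc_at_right)
  then show ?thesis
    unfolding True has_field_derivative_iff by (simp add: flat_exp_def)
next
  case False
  then have t: "0 < t" "t \<le> T" using assms by auto
  have "((\<lambda>t. poly p (1 / t) * exp (- (1 / t))) has_real_derivative
      flat_exp T ([:0, 0, 1:] * (p - pderiv p)) t) (at t)"
    using t by (auto intro!: derivative_eq_intros DERIV_chain2[OF poly_DERIV]
        simp: flat_exp_def power2_eq_square field_simps)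
  then have "((\<lambda>t. poly p (1 / t) * exp (- (1 / t))) has_real_derivative
      flat_exp T ([:0, 0, 1:] * (p - pderiv p)) t) (at t within {0..T})"
    by (rule has_field_derivative_at_within)
  then show ?thesis
    by (rule has_field_derivative_transform_within[of _ _ _ _ t])
       (use t in \<open>auto simp: flat_exp_def dist_real_def\<close>)
qed

lemma flat_exp_flat: "(\<lambda>t. complex_of_real (flat_exp T p t)) \<in> flat T"
proof -
  have "(\<lambda>t. complex_of_real (flat_exp T p t)) \<in> range (\<lambda>p t. complex_of_real (flat_exp T p t))"
    by (rule rangeI)
  then show ?thesis
  proof (coinduct rule: flat_coinduct)
    case (deriv h)
    then obtain p where h: "h = (\<lambda>t. complex_of_real (flat_exp T p t))" by blast
    have "(h has_vector_derivative complex_of_real (flat_exp T ([:0, 0, 1:] * (p - pderiv p)) t))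
      (at t within {0..T})" if "t \<in> {0..T}" for t
      unfolding h using flat_exp_has_derivative[OF that]
      by (intro has_vector_derivative_of_real) (simp add: has_real_derivative_iff_has_vector_derivative)
    then show ?case
      by (intro bexI[OF _ rangeI] ballI)
  qed (auto simp: flat_exp_def)
qed

end

text \<open>
  Approximating \<open>h\<close> by polynomials \<open>p\<close> shows that \<open>\<integral> h\<^sup>2 = \<integral> h (h - p)\<close> is arbitrarily small.
\<close>

lemma real_continuous_eq_0_if_orthogonal_to_polynomials:
  fixes h :: "real \<Rightarrow> real"
  assumes "a < b" and cont: "continuous_on {a..b} h"
    and orth: "\<And>p. real_polynomial_function p \<Longrightarrow> integral {a..b} (\<lambda>s. h s * p s) = 0"
    and "s \<in> {a..b}"
  shows "h s = 0"
proof -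
  obtain B where B: "\<And>s. s \<in> {a..b} \<Longrightarrow> \<bar>h s\<bar> \<le> B" "B > 0"
    using compact_imp_bounded[OF compact_continuous_image[OF cont compact_Icc]]
    unfolding bounded_pos by fastforce
  have "integral {a..b} (\<lambda>s. h s * h s) \<le> 0 + e" if "e > 0" for e
  proof -
    \<comment> \<open>the accuracy for which \<open>\<integral> h (h - p)\<close> is bounded by \<open>e\<close>\<close>
    define d where "d = e / (B * (b - a))"
    have d: "d > 0" "B * d * (b - a) = e"
      using that B(2) \<open>a < b\<close> by (simp_all add: d_def)
    obtain p where p: "real_polynomial_function p" "\<And>s. s \<in> {a..b} \<Longrightarrow> \<bar>h s - p s\<bar> < d"
      using Stone_Weierstrass_real_polynomial_function[OF compact_Icc cont d(1)] by blast
    have pc: "continuous_on {a..b} p"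
      using p(1) by (simp add: continuous_on_polymonial_function real_polynomial_function_eq)
    have "integral {a..b} (\<lambda>s. h s * h s) = integral {a..b} (\<lambda>s. h s * (h s - p s) + h s * p s)"
      by (simp add: algebra_simps)
    also have "\<dots> = integral {a..b} (\<lambda>s. h s * (h s - p s)) + integral {a..b} (\<lambda>s. h s * p s)"
      by (intro Henstock_Kurzweil_Integration.integral_add integrable_continuous_interval continuous_intros cont pc)
    also have "\<dots> = integral {a..b} (\<lambda>s. h s * (h s - p s))"
      by (simp add: orth p(1))
    also have "\<dots> \<le> norm \<dots>" by simp
    also have "\<dots> \<le> (B * d) * (b - a)"
    proof (rule integral_bound)
      show "continuous_on {a..b} (\<lambda>s. h s * (h s - p s))"
        by (intro continuous_intros cont pc)
      show "norm (h s * (h s - p s)) \<le> B * d" if "s \<in> {a..b}" for s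
        unfolding real_norm_def abs_mult
        using B(1)[OF that] p(2)[OF that] B(2) by (intro mult_mono) auto
    qed (use \<open>a < b\<close> in simp)
    finally show ?thesis using d(2) by simp
  qed
  then have "integral {a..b} (\<lambda>s. h s * h s) \<le> 0" by (rule field_le_epsilon)
  moreover have "integral {a..b} (\<lambda>s. h s * h s) \<ge> 0"
    by (intro Henstock_Kurzweil_Integration.integral_nonneg integrable_continuous_interval continuous_intros cont) auto
  ultimately have "integral {a..b} (\<lambda>s. h s * h s) = 0" by simp
  then have "\<forall>s\<in>{a..b}. h s * h s = 0"
    by (subst (asm) integral_eq_0_iff) (auto intro!: continuous_intros cont simp: \<open>a < b\<close>)
  then show ?thesis using assms(4) by auto
qed

lemma continuous_eq_0_if_orthogonal_to_polynomials:
  fixes h :: "real \<Rightarrow> complex"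
  assumes "a < b" and cont: "continuous_on {a..b} h"
    and orth: "\<And>p. integral {a..b} (\<lambda>s. h s * poly p (of_real s)) = 0"
    and "s \<in> {a..b}"
  shows "h s = 0"
proof -
  have zero: "F (h s) = 0"
    if F: "bounded_linear F" "\<And>z r. F (z * of_real r) = F z * r" for F :: "complex \<Rightarrow> real"
  proof (rule real_continuous_eq_0_if_orthogonal_to_polynomials[OF \<open>a < b\<close> _ _ assms(4)])
    show "continuous_on {a..b} (\<lambda>s. F (h s))"
      using F(1) cont by (rule bounded_linear.continuous_on)
    fix p :: "real \<Rightarrow> real" assume "real_polynomial_function p"
    then obtain c n where p: "p = (\<lambda>x. \<Sum>i\<le>n. c i * x ^ i)"
      unfolding real_polynomial_function_iff_sum by blast
    define q :: "complex poly" where "q = (\<Sum>i\<le>n. monom (of_real (c i)) i)"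
    have q: "poly q (of_real s) = of_real (p s)" for s
      by (simp add: q_def p poly_sum poly_monom)
    have "(\<lambda>s. h s * poly q (of_real s)) integrable_on {a..b}"
      by (intro integrable_continuous_interval continuous_intros cont)
    then have "integral {a..b} (F \<circ> (\<lambda>s. h s * poly q (of_real s))) = F 0"
      using integral_linear[OF _ F(1)] orth[of q] by metis
    then show "integral {a..b} (\<lambda>s. F (h s) * p s) = 0"
      using F by (simp add: o_def q linear_simps(3))
  qed
  have "Re (h s) = 0" by (rule zero) (auto intro: bounded_linear_Re)
  moreover have "Im (h s) = 0" by (rule zero) (auto intro: bounded_linear_Im)
  ultimately show ?thesis by (simp add: complex_eq_iff)
qed

context interval
begin

text \<open>
  A single fixed time \<open>t\<close> suffices: testing with \<open>p \<phi>\<close>, where \<open>\<phi>\<close> is flat and positive on \<open>(0, T]\<close>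
  and \<open>p\<close> runs through the polynomials, shows that \<open>k (t - s) \<phi> s\<close> is orthogonal to all polynomials on
  \<open>{0..t}\<close>. Nothing is learnt at \<open>s = 0\<close>, where \<open>\<phi>\<close> vanishes; hence the half-open range of \<open>u\<close>.
\<close>

lemma causal_eq_0_if_annihilates_flat:
  assumes "k \<in> causal T" "0 < t" "t \<le> T"
    and ann: "\<And>g. g \<in> flat T \<Longrightarrow> conv T k g t = 0"
    and "u \<in> {0..<t}"
  shows "k u = 0"
proof -
  define \<phi> where "\<phi> = (\<lambda>s. complex_of_real (flat_exp T 1 s))"
  have \<phi>: "\<phi> \<in> flat T" unfolding \<phi>_def by (rule flat_exp_flat)
  have "k (t - s) * \<phi> s = 0" if "s \<in> {0..t}" for s
  proof (rule continuous_eq_0_if_orthogonal_to_polynomials[OF assms(2) _ _ that])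
    show "continuous_on {0..t} (\<lambda>s. k (t - s) * \<phi> s)"
      using assms(3)
      by (intro continuous_intros continuous_on_compose2[OF causal_continuous[OF assms(1)]]
          continuous_on_compose2[OF causal_continuous[OF flat_causal[OF \<phi>]]]) auto
    show "integral {0..t} (\<lambda>s. k (t - s) * \<phi> s * poly p (of_real s)) = 0" for p
      using ann[OF flat_mult_poly[OF \<phi>, of p]] assms(2,3)
      by (simp add: conv_def volterra_def mult_ac)
  qed
  from this[of "t - u"] show ?thesis
    using assms(3,5) by (auto simp: \<phi>_def flat_exp_def)
qed

lemma flat_div_tendsto_0:
  assumes "f \<in> flat T"
  shows "((\<lambda>u. f u / of_real u) \<longlongrightarrow> 0) (at_right 0)"
proof -
  have "(f has_vector_derivative 0) (at 0 within {0..T})"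
    using flat_has_vector_derivative[OF assms, of 0] flat_0[OF flat_deriv_on[OF assms]] T_pos by simp
  then have "((\<lambda>u. norm (f u - f 0 - u *\<^sub>R 0) / norm u) \<longlongrightarrow> 0) (at_right 0)"
    using T_pos
    by (simp add: has_vector_derivative_def has_derivative_iff_norm at_within_Icc_at_right)
  then show ?thesis
    using flat_0[OF assms]
    by (intro tendsto_norm_zero_cancel[of "\<lambda>u. f u / of_real u"]) (simp add: norm_divide)
qed

lemma frac_kernel_div_tendsto_0:
  assumes "\<mu> > 2"
  shows "((\<lambda>u. frac_kernel T \<mu> u / of_real u) \<longlongrightarrow> 0) (at_right 0)"
proof -
  have "((\<lambda>u. u powr (\<mu> - 2)) \<longlongrightarrow> 0) (at_right (0::real))"
    using assms
    by (auto intro!: tendsto_zero_powrI tendsto_eq_intros eventually_at_right_less[THEN eventually_mono])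
  then have "((\<lambda>u. complex_of_real (u powr (\<mu> - 2) / Gamma \<mu>)) \<longlongrightarrow> of_real (0 / Gamma \<mu>)) (at_right 0)"
    using Gamma_real_nonzero[of \<mu>] assms by (intro tendsto_of_real tendsto_divide tendsto_const) auto
  moreover have "\<forall>\<^sub>F u in at_right 0. complex_of_real (u powr (\<mu> - 2) / Gamma \<mu>) = frac_kernel T \<mu> u / of_real u"
    using eventually_at_right_real[OF T_pos]
  proof eventually_elim
    case (elim u)
    then have "u powr (\<mu> - 1) = u * u powr (\<mu> - 2)"
      by (simp add: powr_mult_base)
    then show ?case using elim by (simp add: frac_kernel_def)
  qed
  ultimately show ?thesis
    by (auto elim: Lim_transform_eventually)
qed

end

section \<open>Linear operators on flat functions\<close>

text \<open>
  The elements of \<open>End(\<M>)\<close>, each encoded as an operator that is zero outside \<open>flat T\<close>. Linearity is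
  what lets \<open>A \<circ> (B + C)\<close> be expanded, and vanishing outside \<open>flat T\<close> makes two such operators equal as
  soon as they agree on flat functions.
\<close>

definition flat_linear :: "real \<Rightarrow> oper \<Rightarrow> bool" where
  "flat_linear T A \<longleftrightarrow>
     (\<forall>f. f \<notin> flat T \<longrightarrow> A f = 0) \<and> (\<forall>f\<in>flat T. A f \<in> flat T) \<and>
     (\<forall>f\<in>flat T. \<forall>g\<in>flat T. \<forall>a b.
        A (\<lambda>t. a * f t + b * g t) = (\<lambda>t. a * A f t + b * A g t))"

context interval
begin

lemma flat_linear_outside: "flat_linear T A \<Longrightarrow> f \<notin> flat T \<Longrightarrow> A f = 0"
  by (simp add: flat_linear_def)

lemma zero_flat: "0 \<in> flat T"
  using flat_zero by (simp add: zero_fun_def)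

lemma flat_linear_flat: "flat_linear T A \<Longrightarrow> A f \<in> flat T"
  unfolding flat_linear_def using zero_flat by (cases "f \<in> flat T") auto

lemma flat_linear_lincomb:
  "flat_linear T A \<Longrightarrow> f \<in> flat T \<Longrightarrow> g \<in> flat T \<Longrightarrow>
    A (\<lambda>t. a * f t + b * g t) = (\<lambda>t. a * A f t + b * A g t)"
  by (simp add: flat_linear_def)

lemma flat_linear_zero:
  assumes "flat_linear T A" shows "A 0 = 0"
  using flat_linear_lincomb[OF assms zero_flat zero_flat, of 0 0] by (simp add: zero_fun_def)

lemma flat_linearI:
  assumes "\<And>f. f \<in> flat T \<Longrightarrow> A f \<in> flat T"
    and "\<And>f g a b. f \<in> flat T \<Longrightarrow> g \<in> flat T \<Longrightarrow>
      A (\<lambda>t. a * f t + b * g t) = (\<lambda>t. a * A f t + b * A g t)"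
  shows "flat_linear T (on_flat T A)"
  using assms by (simp add: flat_linear_def on_flat_def flat_lincomb)

lemma conv_op_eq: "conv_op T k = on_flat T (conv T k)"
  by (simp add: conv_op_def kernel_op_def conv_def [abs_def])

lemma flat_linear_mult_op: "flat_linear T (mult_op T p)"
  unfolding mult_op_def by (intro flat_linearI flat_mult_poly) (simp_all add: fun_eq_iff algebra_simps)

lemma flat_linear_deriv_op: "flat_linear T (deriv_op T \<gamma>)"
  unfolding deriv_op_def by (intro flat_linearI frac_deriv_flat frac_deriv_lincomb)

lemma flat_linear_conv_op: "k \<in> flat T \<Longrightarrow> flat_linear T (conv_op T k)"
  unfolding conv_op_eq by (intro flat_linearI conv_flat conv_lincomb_right flat_causal)

lemma flat_linear_compose: "flat_linear T A \<Longrightarrow> flat_linear T B \<Longrightarrow> flat_linear T (A \<circ> B)"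
  using flat_linear_zero[of A] by (simp add: flat_linear_def zero_fun_def)

lemma flat_linear_add: "flat_linear T A \<Longrightarrow> flat_linear T B \<Longrightarrow> flat_linear T (A + B)"
  by (auto simp: flat_linear_def plus_fun_def zero_fun_def flat_add fun_eq_iff algebra_simps)

lemma compose_add_left: "(A + B) \<circ> C = (A \<circ> C) + (B \<circ> C)" for A B :: oper and C :: oper
  by (simp add: fun_eq_iff)

lemma compose_add_right:
  assumes "flat_linear T A" "flat_linear T B" "flat_linear T C"
  shows "A \<circ> (B + C) = (A \<circ> B) + (A \<circ> C)"
proof
  fix f
  show "(A \<circ> (B + C)) f = ((A \<circ> B) + (A \<circ> C)) f"
    using flat_linear_lincomb[OF assms(1) flat_linear_flat[OF assms(2), of f] flat_linear_flat[OF assms(3), of f], of 1 1]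
    by (simp add: plus_fun_def)
qed

lemma flat_operator_eqI:
  assumes "flat_linear T A" "flat_linear T B" "\<And>f t. f \<in> flat T \<Longrightarrow> A f t = B f t"
  shows "A = B"
proof
  fix f show "A f = B f"
    using assms flat_linear_outside by (cases "f \<in> flat T") auto
qed

lemmas flat_linear_intros =
  flat_linear_mult_op flat_linear_deriv_op flat_linear_conv_op flat_linear_compose flat_linear_add

lemma mult_op_apply: "f \<in> flat T \<Longrightarrow> mult_op T p f = (\<lambda>t. poly p (of_real t) * f t)"
  by (simp add: mult_op_def on_flat_def)

lemma deriv_op_apply: "f \<in> flat T \<Longrightarrow> deriv_op T \<gamma> f = frac_deriv T \<gamma> f"
  by (simp add: deriv_op_def on_flat_def)

lemma conv_op_apply: "f \<in> flat T \<Longrightarrow> conv_op T k f = conv T k f"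
  by (simp add: conv_op_eq on_flat_def)

lemmas op_apply = mult_op_apply deriv_op_apply conv_op_apply flat_mult_poly flat_mult_t frac_deriv_flat
  conv_flat flat_causal

section \<open>Commutation relations between the generators\<close>

lemma mult_op_mult_op: "mult_op T p \<circ> mult_op T q = mult_op T (p * q)"
  by (rule flat_operator_eqI) (auto intro: flat_linear_intros simp: op_apply)

lemma mult_op_add: "mult_op T (p + q) = mult_op T p + mult_op T q"
  by (rule flat_operator_eqI) (auto intro: flat_linear_intros simp: op_apply algebra_simps)

lemma mult_op_zero: "mult_op T 0 = 0"
  by (simp add: mult_op_def on_flat_def fun_eq_iff zero_fun_def)

text \<open>
  The step that drives the inductions on polynomials below.
\<close>

lemma mult_op_pCons: "mult_op T (pCons a p) = mult_op T [:a:] + (mult_op T [:0, 1:] \<circ> mult_op T p)"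
  by (simp add: mult_op_mult_op flip: mult_op_add)

lemma cscale_eq:
  assumes "flat_linear T A" shows "cscale c A = mult_op T [:c:] \<circ> A"
  using flat_linear_flat[OF assms] by (simp add: cscale_def fun_eq_iff mult_op_apply)

lemma deriv_op_deriv_op: "deriv_op T \<alpha> \<circ> deriv_op T \<beta> = deriv_op T (\<alpha> + \<beta>)"
  by (rule flat_operator_eqI) (auto intro: flat_linear_intros simp: op_apply frac_deriv_frac_deriv)

lemma deriv_op_0_right: "A = A \<circ> deriv_op T 0" if "flat_linear T A"
  by (rule flat_operator_eqI) (use that in \<open>auto intro: flat_linear_intros simp: op_apply frac_deriv_def\<close>)

lemma deriv_op_const: "deriv_op T \<alpha> \<circ> mult_op T [:c:] = mult_op T [:c:] \<circ> deriv_op T \<alpha>"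
proof (rule flat_operator_eqI)
  fix f t assume "f \<in> flat T"
  then show "(deriv_op T \<alpha> \<circ> mult_op T [:c:]) f t = (mult_op T [:c:] \<circ> deriv_op T \<alpha>) f t"
    using frac_deriv_lincomb[of f f \<alpha> c 0] flat_scale[of f c] by (simp add: op_apply)
qed (auto intro: flat_linear_intros)

lemma deriv_op_var:
  "deriv_op T \<alpha> \<circ> mult_op T [:0, 1:] =
    (mult_op T [:0, 1:] \<circ> deriv_op T \<alpha>) + (mult_op T [:of_real \<alpha>:] \<circ> deriv_op T (\<alpha> - 1))"
  by (rule flat_operator_eqI) (auto intro: flat_linear_intros simp: op_apply frac_deriv_mult_t)

lemma conv_op_const:
  assumes "k \<in> flat T"
  shows "conv_op T k \<circ> mult_op T [:c:] = mult_op T [:c:] \<circ> conv_op T k"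
proof (rule flat_operator_eqI)
  fix f t assume "f \<in> flat T"
  then show "(conv_op T k \<circ> mult_op T [:c:]) f t = (mult_op T [:c:] \<circ> conv_op T k) f t"
    using conv_lincomb_right[of k f f c 0] flat_scale[of f c] assms by (simp add: op_apply)
qed (use assms in \<open>auto intro: flat_linear_intros\<close>)

text \<open>
  From \<open>t = (t - s) + s\<close> under the integral sign.
\<close>

lemma conv_op_var:
  assumes "k \<in> flat T"
  shows "conv_op T k \<circ> mult_op T [:0, 1:] =
    (mult_op T [:0, 1:] \<circ> conv_op T k) + (mult_op T [:- 1:] \<circ> conv_op T (\<lambda>t. of_real t * k t))"
proof (rule flat_operator_eqI)
  fix f t assume "f \<in> flat T"
  then show "(conv_op T k \<circ> mult_op T [:0, 1:]) f t =
      ((mult_op T [:0, 1:] \<circ> conv_op T k) + (mult_op T [:- 1:] \<circ> conv_op T (\<lambda>t. of_real t * k t))) f t"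
    using mult_t_conv[of k f t] assms by (simp add: op_apply)
qed (use assms in \<open>auto intro!: flat_linear_intros flat_mult_t\<close>)

lemma deriv_op_conv_op:
  assumes "k \<in> flat T"
  shows "deriv_op T \<alpha> \<circ> conv_op T k = conv_op T (frac_deriv T \<alpha> k)"
proof (rule flat_operator_eqI)
  fix f t assume "f \<in> flat T"
  then show "(deriv_op T \<alpha> \<circ> conv_op T k) f t = conv_op T (frac_deriv T \<alpha> k) f t"
    using frac_deriv_conv[OF flat_causal assms, of f \<alpha>] assms
    by (simp add: op_apply conv_commute[of _ f])
qed (use assms in \<open>auto intro!: flat_linear_intros frac_deriv_flat\<close>)

lemma conv_op_deriv_op:
  assumes "k \<in> flat T"
  shows "conv_op T k \<circ> deriv_op T \<alpha> = conv_op T (frac_deriv T \<alpha> k)"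
proof (rule flat_operator_eqI)
  fix f t assume "f \<in> flat T"
  then show "(conv_op T k \<circ> deriv_op T \<alpha>) f t = conv_op T (frac_deriv T \<alpha> k) f t"
    using frac_deriv_conv[OF flat_causal[OF assms], of f \<alpha>] frac_deriv_conv[OF flat_causal assms, of f \<alpha>] assms
    by (simp add: op_apply conv_commute[of _ f])
qed (use assms in \<open>auto intro!: flat_linear_intros frac_deriv_flat\<close>)

lemma conv_op_conv_op:
  assumes "k \<in> flat T" "l \<in> flat T"
  shows "conv_op T k \<circ> conv_op T l = conv_op T (conv T k l)"
  by (rule flat_operator_eqI)
    (use assms in \<open>auto intro!: flat_linear_intros conv_flat flat_causal simp: op_apply conv_assoc\<close>)

end

section \<open>Operators of bounded order\<close>

text \<open>
  The set \<open>flat_volterra T\<close> (see \<open>flat_volterra_eq_smoothing\<close>), generated from single terms so that its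
  closure properties can be proved by induction.
\<close>

inductive_set smoothing :: "real \<Rightarrow> oper set" for T where
  base: "k \<in> flat T \<Longrightarrow> mult_op T p \<circ> conv_op T k \<in> smoothing T"
| add: "A \<in> smoothing T \<Longrightarrow> B \<in> smoothing T \<Longrightarrow> A + B \<in> smoothing T"

text \<open>
  The operators having a normal form with exponents at most \<open>r\<close>, described without reference to
  coefficients, so that they can be composed before uniqueness of normal forms is known.
\<close>

inductive_set order_le :: "real \<Rightarrow> real set \<Rightarrow> real \<Rightarrow> oper set" for T \<Gamma> r where
  diff: "\<gamma> \<in> \<Gamma> \<Longrightarrow> \<gamma> \<le> r \<Longrightarrow> mult_op T p \<circ> deriv_op T \<gamma> \<in> order_le T \<Gamma> r"
| smooth: "A \<in> smoothing T \<Longrightarrow> A \<in> order_le T \<Gamma> r"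
| add: "A \<in> order_le T \<Gamma> r \<Longrightarrow> B \<in> order_le T \<Gamma> r \<Longrightarrow> A + B \<in> order_le T \<Gamma> r"

text \<open>
  Membership in these sets is proved by rewriting operators as composites and sums, so neither
  may be unfolded pointwise by the simplifier.
\<close>

declare o_apply [simp del] plus_fun_apply [simp del]

lemma order_le_mono: "A \<in> order_le T \<Gamma> r \<Longrightarrow> r \<le> s \<Longrightarrow> A \<in> order_le T \<Gamma> s"
  by (induction rule: order_le.induct) (auto intro: order_le.intros)

context interval
begin

lemma flat_linear_smoothing: "A \<in> smoothing T \<Longrightarrow> flat_linear T A"
  by (induction rule: smoothing.induct) (auto intro: flat_linear_intros)

lemma flat_linear_order_le: "A \<in> order_le T \<Gamma> r \<Longrightarrow> flat_linear T A"
  by (induction rule: order_le.induct) (auto intro: flat_linear_intros flat_linear_smoothing)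

lemma zero_smoothing: "0 \<in> smoothing T"
  using smoothing.base[OF flat_zero, of 0] by (simp add: mult_op_zero fun_eq_iff o_def zero_fun_def)

lemma mult_op_smoothing: "A \<in> smoothing T \<Longrightarrow> mult_op T p \<circ> A \<in> smoothing T"
proof (induction rule: smoothing.induct)
  case (base k q)
  then show ?case
    using smoothing.base[OF base, of "p * q"] by (simp add: mult_op_mult_op o_assoc)
next
  case (add A B)
  then show ?case
    by (simp add: compose_add_right flat_linear_smoothing flat_linear_mult_op smoothing.add)
qed

lemma mult_op_order_le: "A \<in> order_le T \<Gamma> r \<Longrightarrow> mult_op T p \<circ> A \<in> order_le T \<Gamma> r"
proof (induction rule: order_le.induct)
  case (diff \<gamma> q)
  then show ?case
    using order_le.diff[OF diff, of T "p * q"] by (simp add: mult_op_mult_op o_assoc)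
next
  case (add A B)
  then show ?case
    by (simp add: compose_add_right flat_linear_order_le flat_linear_mult_op order_le.add)
qed (simp add: order_le.smooth mult_op_smoothing)

lemma smoothing_deriv_op: "A \<in> smoothing T \<Longrightarrow> A \<circ> deriv_op T \<gamma> \<in> smoothing T"
proof (induction rule: smoothing.induct)
  case (base k p)
  then show ?case
    by (simp add: o_assoc[symmetric] conv_op_deriv_op smoothing.base frac_deriv_flat)
qed (simp add: compose_add_left smoothing.add)

text \<open>
  Moving one factor \<open>t\<close> to the left replaces \<open>k\<close> by \<open>t k\<close>, so the induction is over all kernels at once.
\<close>

lemma conv_op_mult_op: "k \<in> flat T \<Longrightarrow> conv_op T k \<circ> mult_op T q \<in> smoothing T"
proof (induction q arbitrary: k)
  case 0
  then have "conv_op T k \<circ> mult_op T 0 = 0"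
    using flat_linear_zero[OF flat_linear_conv_op[OF 0]]
    by (simp add: mult_op_zero fun_eq_iff o_apply)
  then show ?case by (simp only: zero_smoothing)
next
  case (pCons a q)
  let ?X = "mult_op T [:0, 1:]" and ?l = "\<lambda>t. of_real t * k t"
  have "conv_op T k \<circ> mult_op T (pCons a q) =
      (conv_op T k \<circ> mult_op T [:a:]) + ((conv_op T k \<circ> ?X) \<circ> mult_op T q)"
    using pCons.prems
    by (simp only: mult_op_pCons[of a q] compose_add_right flat_linear_intros o_assoc)
  also have "\<dots> = (mult_op T [:a:] \<circ> conv_op T k) + ((?X \<circ> (conv_op T k \<circ> mult_op T q)) +
      (mult_op T [:- 1:] \<circ> (conv_op T ?l \<circ> mult_op T q)))"
    using pCons.prems by (simp only: conv_op_const conv_op_var compose_add_left o_assoc)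
  also have "\<dots> \<in> smoothing T"
    by (intro smoothing.add smoothing.base mult_op_smoothing pCons.IH pCons.prems flat_mult_t)
  finally show ?case .
qed

lemma smoothing_mult_op: "A \<in> smoothing T \<Longrightarrow> A \<circ> mult_op T q \<in> smoothing T"
proof (induction rule: smoothing.induct)
  case (base k p)
  then show ?case
    using mult_op_smoothing[OF conv_op_mult_op[OF base, of q], of p] by (simp add: o_assoc)
qed (simp add: compose_add_left smoothing.add)

lemma smoothing_conv_op:
  assumes "l \<in> flat T"
  shows "A \<in> smoothing T \<Longrightarrow> A \<circ> conv_op T l \<in> smoothing T"
proof (induction rule: smoothing.induct)
  case (base k p)
  then show ?case
    using assms
    by (simp add: o_assoc[symmetric] conv_op_conv_op smoothing.base conv_flat flat_causal)
qed (simp add: compose_add_left smoothing.add)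

lemma order_le_conv_op:
  assumes "l \<in> flat T"
  shows "A \<in> order_le T \<Gamma> r \<Longrightarrow> A \<circ> conv_op T l \<in> smoothing T"
proof (induction rule: order_le.induct)
  case (diff \<gamma> p)
  then show ?case
    using assms
    by (simp add: o_assoc[symmetric] deriv_op_conv_op smoothing.base frac_deriv_flat)
qed (simp_all add: compose_add_left smoothing.add smoothing_conv_op assms)

end

locale exponent_group = interval +
  fixes \<Gamma> :: "real set"
  assumes add_closed: "\<alpha> \<in> \<Gamma> \<Longrightarrow> \<beta> \<in> \<Gamma> \<Longrightarrow> \<alpha> + \<beta> \<in> \<Gamma>"
    and Ints_subset: "\<int> \<subseteq> \<Gamma>"
begin

lemma zero_in: "0 \<in> \<Gamma>" using Ints_subset by auto

lemma minus_one_closed: "\<alpha> \<in> \<Gamma> \<Longrightarrow> \<alpha> - 1 \<in> \<Gamma>"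
  using add_closed[of \<alpha> "- 1"] subsetD[OF Ints_subset, of "- 1"] by simp

lemma order_le_deriv_op:
  assumes "\<beta> \<in> \<Gamma>"
  shows "A \<in> order_le T \<Gamma> r \<Longrightarrow> A \<circ> deriv_op T \<beta> \<in> order_le T \<Gamma> (r + \<beta>)"
proof (induction rule: order_le.induct)
  case (diff \<gamma> p)
  then show ?case
    using assms
    by (simp add: o_assoc[symmetric] deriv_op_deriv_op order_le.diff add_closed)
qed (simp_all add: compose_add_left order_le.add order_le.smooth smoothing_deriv_op)

text \<open>
  Moving one factor \<open>t\<close> to the left produces \<open>\<alpha> D\<^sup>\<alpha>\<^sup>-\<^sup>1\<close>, to which the induction hypothesis is applied
  with the exponent \<open>\<alpha> - 1\<close>; this is why \<open>\<alpha>\<close> must be arbitrary and why \<open>\<Gamma>\<close> has to be closed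
  under subtracting \<open>1\<close>.
\<close>

lemma deriv_op_mult_op_commutator:
  "\<alpha> \<in> \<Gamma> \<Longrightarrow> \<exists>C\<in>order_le T \<Gamma> (\<alpha> - 1).
     deriv_op T \<alpha> \<circ> mult_op T q = (mult_op T q \<circ> deriv_op T \<alpha>) + C"
proof (induction q arbitrary: \<alpha>)
  case 0
  have "deriv_op T \<alpha> \<circ> mult_op T 0 = (mult_op T 0 \<circ> deriv_op T \<alpha>) + 0"
    using flat_linear_zero[OF flat_linear_deriv_op[of \<alpha>]]
    by (simp add: mult_op_zero fun_eq_iff o_apply plus_fun_apply)
  then show ?case using order_le.smooth[OF zero_smoothing] by blast
next
  case (pCons a q)
  let ?D = "deriv_op T \<alpha>" and ?X = "mult_op T [:0, 1:]" and ?a = "mult_op T [:of_real \<alpha>:]"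
  obtain C where C: "C \<in> order_le T \<Gamma> (\<alpha> - 1)" "?D \<circ> mult_op T q = (mult_op T q \<circ> ?D) + C"
    using pCons.IH[OF pCons.prems] by blast
  obtain C' where C': "C' \<in> order_le T \<Gamma> (\<alpha> - 1 - 1)"
    "deriv_op T (\<alpha> - 1) \<circ> mult_op T q = (mult_op T q \<circ> deriv_op T (\<alpha> - 1)) + C'"
    using pCons.IH[OF minus_one_closed[OF pCons.prems]] by blast
  have C'': "(mult_op T q \<circ> deriv_op T (\<alpha> - 1)) + C' \<in> order_le T \<Gamma> (\<alpha> - 1)"
    by (intro order_le.add order_le.diff minus_one_closed order_le_mono[OF C'(1)] pCons.prems) simp_all
  have "?D \<circ> mult_op T (pCons a q) = (?D \<circ> mult_op T [:a:]) + ((?D \<circ> ?X) \<circ> mult_op T q)"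
    by (simp only: mult_op_pCons[of a q] compose_add_right flat_linear_intros o_assoc)
  also have "\<dots> = (mult_op T [:a:] \<circ> ?D) +
      ((?X \<circ> (?D \<circ> mult_op T q)) + (?a \<circ> (deriv_op T (\<alpha> - 1) \<circ> mult_op T q)))"
    by (simp only: deriv_op_const deriv_op_var compose_add_left o_assoc)
  also have "?X \<circ> (?D \<circ> mult_op T q) = ((?X \<circ> mult_op T q) \<circ> ?D) + (?X \<circ> C)"
    unfolding C(2)
    by (simp add: compose_add_right flat_linear_intros flat_linear_order_le[OF C(1)] o_assoc)
  finally have "?D \<circ> mult_op T (pCons a q) = (mult_op T (pCons a q) \<circ> ?D) +
      ((?X \<circ> C) + (?a \<circ> ((mult_op T q \<circ> deriv_op T (\<alpha> - 1)) + C')))"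
    unfolding C'(2) mult_op_pCons[of a q] compose_add_left by (simp only: add.assoc)
  moreover have "(?X \<circ> C) + (?a \<circ> ((mult_op T q \<circ> deriv_op T (\<alpha> - 1)) + C')) \<in> order_le T \<Gamma> (\<alpha> - 1)"
    by (intro order_le.add[OF mult_op_order_le mult_op_order_le] C(1) C'')
  ultimately show ?case by blast
qed

lemma order_le_mult_op: "A \<in> order_le T \<Gamma> r \<Longrightarrow> A \<circ> mult_op T q \<in> order_le T \<Gamma> r"
proof (induction rule: order_le.induct)
  case (diff \<gamma> p)
  obtain C where C: "C \<in> order_le T \<Gamma> (\<gamma> - 1)"
    "deriv_op T \<gamma> \<circ> mult_op T q = (mult_op T q \<circ> deriv_op T \<gamma>) + C"
    using deriv_op_mult_op_commutator[OF diff(1)] by blast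
  have "deriv_op T \<gamma> \<circ> mult_op T q \<in> order_le T \<Gamma> r"
    unfolding C(2) using diff(2) by (intro order_le.add order_le.diff order_le_mono[OF C(1)] diff) simp
  then show ?case using mult_op_order_le by (simp add: o_assoc[symmetric])
qed (simp_all add: compose_add_left order_le.add order_le.smooth smoothing_mult_op)

lemma order_le_smoothing:
  assumes "A \<in> order_le T \<Gamma> r"
  shows "B \<in> smoothing T \<Longrightarrow> A \<circ> B \<in> smoothing T"
proof (induction rule: smoothing.induct)
  case (base k p)
  then show ?case
    using order_le_conv_op[OF base order_le_mult_op[OF assms]] by (simp add: o_assoc)
next
  case (add B C)
  then show ?case
    by (simp add: compose_add_right flat_linear_smoothing flat_linear_order_le[OF assms] smoothing.add)
qed

lemma order_le_compose:
  assumes "A \<in> order_le T \<Gamma> r"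
  shows "B \<in> order_le T \<Gamma> s \<Longrightarrow> A \<circ> B \<in> order_le T \<Gamma> (r + s)"
proof (induction rule: order_le.induct)
  case (diff \<gamma> p)
  have "A \<circ> (mult_op T p \<circ> deriv_op T \<gamma>) \<in> order_le T \<Gamma> (r + \<gamma>)"
    using order_le_deriv_op[OF diff(1) order_le_mult_op[OF assms]] by (simp add: o_assoc)
  then show ?case using diff by (elim order_le_mono) simp
next
  case (add B C)
  then show ?case
    by (simp add: compose_add_right flat_linear_order_le[OF assms] flat_linear_order_le order_le.add)
qed (simp add: order_le.smooth order_le_smoothing[OF assms])

lemma leading_term_compose:
  assumes "\<alpha> \<in> \<Gamma>" "\<beta> \<in> \<Gamma>"
  shows "\<exists>C\<in>order_le T \<Gamma> (\<alpha> + \<beta> - 1).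
    (mult_op T p \<circ> deriv_op T \<alpha>) \<circ> (mult_op T q \<circ> deriv_op T \<beta>) =
    (mult_op T (p * q) \<circ> deriv_op T (\<alpha> + \<beta>)) + C"
proof -
  obtain C where C: "C \<in> order_le T \<Gamma> (\<alpha> - 1)"
    "deriv_op T \<alpha> \<circ> mult_op T q = (mult_op T q \<circ> deriv_op T \<alpha>) + C"
    using deriv_op_mult_op_commutator[OF assms(1)] by blast
  have "(mult_op T p \<circ> deriv_op T \<alpha>) \<circ> (mult_op T q \<circ> deriv_op T \<beta>) =
      (mult_op T p \<circ> (deriv_op T \<alpha> \<circ> mult_op T q)) \<circ> deriv_op T \<beta>"
    by (simp only: o_assoc)
  also have "\<dots> = ((mult_op T p \<circ> mult_op T q) \<circ> (deriv_op T \<alpha> \<circ> deriv_op T \<beta>)) +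
      ((mult_op T p \<circ> C) \<circ> deriv_op T \<beta>)"
    unfolding C(2)
    by (simp only: compose_add_right compose_add_left flat_linear_intros flat_linear_order_le[OF C(1)] o_assoc)
  finally have "(mult_op T p \<circ> deriv_op T \<alpha>) \<circ> (mult_op T q \<circ> deriv_op T \<beta>) =
      (mult_op T (p * q) \<circ> deriv_op T (\<alpha> + \<beta>)) + ((mult_op T p \<circ> C) \<circ> deriv_op T \<beta>)"
    by (simp only: mult_op_mult_op deriv_op_deriv_op)
  moreover have "(mult_op T p \<circ> C) \<circ> deriv_op T \<beta> \<in> order_le T \<Gamma> (\<alpha> + \<beta> - 1)"
    using order_le_deriv_op[OF assms(2) mult_op_order_le[OF C(1)]] by (simp add: algebra_simps)
  ultimately show ?thesis by blast
qed

end

section \<open>Independence of the generators modulo smoothing operators\<close>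

context interval
begin

text \<open>
  After composition with \<open>D\<^sup>-\<^sup>a\<^sup>-\<^sup>2\<close> and at a fixed time, an operator of order below \<open>a\<close> is convolution
  with a causal kernel that is \<open>o(u)\<close> at the origin: a term with exponent \<open>\<gamma> < a\<close> has a kernel
  proportional to \<open>u\<close> raised to \<open>a + 1 - \<gamma> > 1\<close>, and a smoothing operator has a flat kernel. The shift
  by \<open>2\<close> is what makes \<open>u\<close> itself the kernel belonging to \<open>D\<^sup>a\<close>.
\<close>

lemma order_le_kernel:
  assumes "c < a" "0 < t" "t \<le> T" "X \<in> order_le T \<Gamma> c"
  shows "\<exists>G\<in>causal T. ((\<lambda>u. G u / of_real u) \<longlongrightarrow> 0) (at_right 0) \<and>
    (\<forall>g\<in>flat T. X (deriv_op T (- (a + 2)) g) t = conv T G g t)" (is "?kernel X")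
proof -
  have plus: "?kernel (A + B)" if "?kernel A" "?kernel B" for A B
  proof -
    from that obtain G H where "G \<in> causal T" "H \<in> causal T"
      "((\<lambda>u. G u / of_real u) \<longlongrightarrow> 0) (at_right 0)" "((\<lambda>u. H u / of_real u) \<longlongrightarrow> 0) (at_right 0)"
      "\<forall>g\<in>flat T. A (deriv_op T (- (a + 2)) g) t = conv T G g t"
      "\<forall>g\<in>flat T. B (deriv_op T (- (a + 2)) g) t = conv T H g t"
      by blast
    then show ?thesis
      using causal_lincomb[of G H 1 1] tendsto_add[of "\<lambda>u. G u / of_real u" 0 _ "\<lambda>u. H u / of_real u" 0]
        conv_lincomb_left[OF flat_causal, of _ G H 1 1]
      by (intro bexI[of _ "\<lambda>u. G u + H u"]) (simp_all add: plus_fun_apply add_divide_distrib)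
  qed
  have smoothing: "?kernel A" if "A \<in> smoothing T" for A
    using that
  proof (induction rule: smoothing.induct)
    case (base k p)
    define l where "l = frac_deriv T (- (a + 2)) k"
    define G where "G = (\<lambda>u. poly p (of_real t) * l u)"
    have l: "l \<in> flat T" unfolding l_def by (rule frac_deriv_flat[OF base])
    have G: "G \<in> flat T" unfolding G_def by (rule flat_scale[OF l])
    have "(mult_op T p \<circ> conv_op T k) (deriv_op T (- (a + 2)) g) t = conv T G g t" if "g \<in> flat T" for g
    proof -
      have "conv_op T k (deriv_op T (- (a + 2)) g) = conv T l g"
        using fun_cong[OF conv_op_deriv_op[OF base, of "- (a + 2)"], of g] that
        by (simp add: o_apply l_def conv_op_apply)
      then have "(mult_op T p \<circ> conv_op T k) (deriv_op T (- (a + 2)) g) t = poly p (of_real t) * conv T l g t"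
        using that l by (simp add: o_apply mult_op_apply conv_flat flat_causal)
      also have "\<dots> = conv T G g t"
        using conv_lincomb_left[of g l l "poly p (of_real t)" 0] that l
        by (simp add: G_def flat_causal)
      finally show ?thesis .
    qed
    then show ?case using flat_causal[OF G] flat_div_tendsto_0[OF G] by blast
  qed (rule plus)
  show ?thesis
    using assms(4)
  proof (induction rule: order_le.induct)
    case (diff \<gamma> p)
    define \<mu> where "\<mu> = a + 2 - \<gamma>"
    define G where "G = (\<lambda>u. poly p (of_real t) * frac_kernel T \<mu> u + 0 * frac_kernel T \<mu> u)"
    have \<mu>: "\<mu> > 2" using diff(2) assms(1) by (simp add: \<mu>_def)
    have pc: "frac_kernel T \<mu> \<in> causal T" using \<mu> by (intro frac_kernel_causal) simp
    have G: "G \<in> causal T" unfolding G_def using pc by (intro causal_lincomb)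
    have "((\<lambda>u. poly p (of_real t) * (frac_kernel T \<mu> u / of_real u)) \<longlongrightarrow> poly p (of_real t) * 0) (at_right 0)"
      by (intro tendsto_mult tendsto_const frac_kernel_div_tendsto_0 \<mu>)
    then have lim: "((\<lambda>u. G u / of_real u) \<longlongrightarrow> 0) (at_right 0)"
      by (simp add: G_def)
    have "(mult_op T p \<circ> deriv_op T \<gamma>) (deriv_op T (- (a + 2)) g) t = conv T G g t" if "g \<in> flat T" for g
    proof -
      have sum: "\<gamma> + - (a + 2) = - \<mu>" by (simp add: \<mu>_def)
      have "deriv_op T \<gamma> (deriv_op T (- (a + 2)) g) = frac_deriv T (- \<mu>) g"
        using that by (simp only: deriv_op_apply frac_deriv_flat frac_deriv_frac_deriv sum)
      then have "(mult_op T p \<circ> deriv_op T \<gamma>) (deriv_op T (- (a + 2)) g) t =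
          poly p (of_real t) * frac_deriv T (- \<mu>) g t"
        using that by (simp add: o_apply mult_op_apply frac_deriv_flat)
      also have "frac_deriv T (- \<mu>) g = conv T (frac_kernel T \<mu>) g"
        using \<mu> by (simp add: frac_deriv_def frac_int_eq_conv)
      also have "poly p (of_real t) * conv T (frac_kernel T \<mu>) g t = conv T G g t"
        unfolding G_def using pc that by (subst conv_lincomb_left) (simp_all add: flat_causal)
      finally show ?thesis .
    qed
    then show ?case using G lim by blast
  next
    case (smooth A)
    then show ?case by (rule smoothing)
  next
    case (add A B)
    then show ?case using plus by blast
  qed
qed

text \<open>
  If the sum were zero, the kernel \<open>p(t) u + G(u)\<close> would annihilate all flat functions, hence vanish;
  dividing by \<open>u\<close> and letting \<open>u \<rightarrow> 0\<close> gives \<open>p(t) = 0\<close> for every \<open>t\<close> in \<open>(0, T)\<close>, too many roots.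
\<close>

lemma leading_term_nonzero:
  assumes "p \<noteq> 0" "c < a" "X \<in> order_le T \<Gamma> c"
  shows "(mult_op T p \<circ> deriv_op T a) + X \<noteq> 0"
proof
  assume zero: "(mult_op T p \<circ> deriv_op T a) + X = 0"
  have "poly p (of_real t) = 0" if t: "0 < t" "t < T" for t
  proof -
    obtain G where G: "G \<in> causal T" "((\<lambda>u. G u / of_real u) \<longlongrightarrow> 0) (at_right 0)"
      "\<And>g. g \<in> flat T \<Longrightarrow> X (deriv_op T (- (a + 2)) g) t = conv T G g t"
      using order_le_kernel[OF assms(2) t(1) less_imp_le[OF t(2)] assms(3)] by blast
    have pc: "frac_kernel T 2 \<in> causal T" by (rule frac_kernel_causal) simp
    let ?H = "\<lambda>u. poly p (of_real t) * frac_kernel T 2 u + 1 * G u"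
    have "conv T ?H g t = 0" if g: "g \<in> flat T" for g
    proof -
      have "deriv_op T a (deriv_op T (- (a + 2)) g) = frac_deriv T (- 2) g"
        using g by (simp add: deriv_op_apply frac_deriv_flat frac_deriv_frac_deriv)
      also have "\<dots> = conv T (frac_kernel T 2) g"
        by (simp add: frac_deriv_def frac_int_eq_conv)
      finally have "((mult_op T p \<circ> deriv_op T a) + X) (deriv_op T (- (a + 2)) g) t =
          poly p (of_real t) * conv T (frac_kernel T 2) g t + conv T G g t"
        using g pc by (simp add: o_apply plus_fun_apply mult_op_apply conv_flat G(3) del: minus_add_distrib)
      also have "\<dots> = conv T ?H g t"
        using g pc G(1) by (subst conv_lincomb_left) (simp_all add: flat_causal)
      finally show ?thesis unfolding zero by simp
    qed
    then have H: "?H u = 0" if "u \<in> {0..<t}" for u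
      using t that
      by (intro causal_eq_0_if_annihilates_flat[of ?H t] causal_lincomb pc G(1)) auto
    have "Gamma 2 = (1 :: real)"
      using Gamma_real_plus1[of 1] by simp
    have "G u / of_real u = - poly p (of_real t)" if "0 < u" "u < t" for u
    proof -
      have "poly p (of_real t) * of_real u + G u = 0"
        using H[of u] that t \<open>Gamma 2 = 1\<close> by (simp add: frac_kernel_def)
      then have "G u = - (poly p (of_real t) * of_real u)"
        by (metis add.commute eq_neg_iff_add_eq_0)
      then show ?thesis using that by simp
    qed
    then have "\<forall>\<^sub>F u in at_right 0. G u / of_real u = - poly p (of_real t)"
      using eventually_at_right_real[OF t(1)] by (auto elim: eventually_mono)
    then have "((\<lambda>u. - poly p (of_real t)) \<longlongrightarrow> 0) (at_right (0::real))"
      by (rule Lim_transform_eventually[OF G(2)])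
    then show ?thesis
      by (simp add: tendsto_const_iff)
  qed
  then have "of_real ` {0<..<T} \<subseteq> {z :: complex. poly p z = 0}" by auto
  moreover have "infinite (complex_of_real ` {0<..<T})"
    using T_pos by (subst finite_image_iff) (auto simp: inj_on_def)
  ultimately show False
    using poly_roots_finite[OF assms(1)] finite_subset by blast
qed

section \<open>Normal forms\<close>

lemma zero_compose: "0 \<circ> A = 0" for A :: oper
  by (simp add: fun_eq_iff o_apply)

lemma one_compose: "flat_linear T A \<Longrightarrow> mult_op T 1 \<circ> A = A"
  by (simp add: fun_eq_iff o_apply mult_op_apply flat_linear_flat)

lemma minus_compose: "flat_linear T A \<Longrightarrow> A + (mult_op T [:- 1:] \<circ> A) = 0"
  by (simp add: fun_eq_iff o_apply plus_fun_apply mult_op_apply flat_linear_flat)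

lemma sum_smoothing: "finite I \<Longrightarrow> (\<And>i. i \<in> I \<Longrightarrow> F i \<in> smoothing T) \<Longrightarrow> sum F I \<in> smoothing T"
  by (induction I rule: finite_induct) (simp_all add: zero_smoothing smoothing.add)

lemma sum_order_le: "finite I \<Longrightarrow> (\<And>i. i \<in> I \<Longrightarrow> F i \<in> order_le T \<Gamma> r) \<Longrightarrow> sum F I \<in> order_le T \<Gamma> r"
  by (induction I rule: finite_induct) (simp_all add: order_le.smooth zero_smoothing order_le.add)

lemma sum_oper_apply: "sum F I f t = (\<Sum>i\<in>I. F i f t)" for F :: "'i \<Rightarrow> oper"
  by (induction I rule: infinite_finite_induct) (simp_all add: plus_fun_apply)

lemma sum_split_shift: "(\<Sum>r = 1..N + M. f r) = (\<Sum>r = 1..N. f r) + (\<Sum>r = 1..M. f (r + N))"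
  for f :: "nat \<Rightarrow> 'a::comm_monoid_add" and N M :: nat
  by (induction M) (simp_all add: ac_simps)

lemma kernel_op_eq_sum:
  fixes N :: nat
  assumes "\<forall>r\<in>{1..N}. k r \<in> flat T"
  shows "kernel_op T (\<lambda>t s. if 0 \<le> s \<and> s \<le> t \<and> t \<le> T
      then \<Sum>r = 1..N. poly (p r) (of_real t) * k r (t - s) else 0) =
    (\<Sum>r = 1..N. mult_op T (p r) \<circ> conv_op T (k r))" (is "kernel_op T ?K = ?S")
proof (intro ext)
  fix f t
  have S: "flat_linear T ?S"
    using assms by (intro flat_linear_smoothing sum_smoothing smoothing.base) auto
  consider "f \<notin> flat T" | "f \<in> flat T" "t \<notin> {0..T}" | "f \<in> flat T" "t \<in> {0..T}" by blast
  then show "kernel_op T ?K f t = ?S f t"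
  proof cases
    case 1
    then show ?thesis using flat_linear_outside[OF S] by (simp add: kernel_op_def on_flat_def)
  next
    case 2
    then show ?thesis
      using flat_outside[OF flat_linear_flat[OF S, of f]]
      by (auto simp: kernel_op_def on_flat_def volterra_def)
  next
    case 3
    have I: "((\<lambda>s. k r (t - s) * f s) has_integral conv T (k r) f t) {0..t}" if "r \<in> {1..N}" for r
    proof -
      have "(\<lambda>s. k r (t - s) * f s) integrable_on {0..T}"
        using 3 assms that by (intro conv_integrable flat_causal) auto
      then have "(\<lambda>s. k r (t - s) * f s) integrable_on {0..t}"
        by (rule integrable_on_subinterval) (use 3 in auto)
      then show ?thesis using 3 by (simp add: conv_def volterra_def integrable_integral)
    qed
    have "((\<lambda>s. \<Sum>r = 1..N. poly (p r) (of_real t) * (k r (t - s) * f s)) has_integral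
        (\<Sum>r = 1..N. poly (p r) (of_real t) * conv T (k r) f t)) {0..t}"
      by (intro has_integral_sum has_integral_mult_right I) auto
    then have "((\<lambda>s. ?K t s * f s) has_integral (\<Sum>r = 1..N. poly (p r) (of_real t) * conv T (k r) f t)) {0..t}"
      by (rule has_integral_eq[rotated]) (use 3 in \<open>simp add: sum_distrib_right mult.assoc\<close>)
    then have "kernel_op T ?K f t = (\<Sum>r = 1..N. poly (p r) (of_real t) * conv T (k r) f t)"
      using 3 by (simp only: kernel_op_def on_flat_def volterra_def integral_unique if_True)
    also have "\<dots> = ?S f t"
      using 3 assms
      by (simp add: sum_oper_apply o_apply conv_op_apply mult_op_apply conv_flat flat_causal)
    finally show ?thesis .
  qed
qed

lemma flat_volterra_eq_smoothing: "flat_volterra T = smoothing T"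
proof
  show "flat_volterra T \<subseteq> smoothing T"
    unfolding flat_volterra_def flat_kernels_def
    by (auto simp: kernel_op_eq_sum intro!: sum_smoothing smoothing.base)
  show "smoothing T \<subseteq> flat_volterra T"
  proof
    fix A assume "A \<in> smoothing T"
    then have "\<exists>N p k. (\<forall>r\<in>{1..N::nat}. k r \<in> flat T) \<and> A = (\<Sum>r = 1..N. mult_op T (p r) \<circ> conv_op T (k r))"
    proof (induction rule: smoothing.induct)
      case (base k p)
      then show ?case
        by (intro exI[of _ "1::nat"] exI[of _ "\<lambda>_. p"] exI[of _ "\<lambda>_. k"]) simp
    next
      case (add A B)
      from add.IH(1) obtain N p k where
        A: "\<forall>r\<in>{1..N::nat}. k r \<in> flat T" "A = (\<Sum>r = 1..N. mult_op T (p r) \<circ> conv_op T (k r))"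
        by blast
      from add.IH(2) obtain M q l where
        B: "\<forall>r\<in>{1..M::nat}. l r \<in> flat T" "B = (\<Sum>r = 1..M. mult_op T (q r) \<circ> conv_op T (l r))"
        by blast
      define p' k' where "p' = (\<lambda>r. if r \<le> N then p r else q (r - N))"
        and "k' = (\<lambda>r. if r \<le> N then k r else l (r - N))"
      have "(\<Sum>r = 1..N + M. mult_op T (p' r) \<circ> conv_op T (k' r)) =
        (\<Sum>r = 1..N. mult_op T (p' r) \<circ> conv_op T (k' r)) +
        (\<Sum>r = 1..M. mult_op T (p' (r + N)) \<circ> conv_op T (k' (r + N)))"
        by (rule sum_split_shift)
      also have "\<dots> = A + B"
        unfolding A(2) B(2) p'_def k'_def by (intro arg_cong2[where f = plus] sum.cong) auto
      finally have "A + B = (\<Sum>r = 1..N + M. mult_op T (p' r) \<circ> conv_op T (k' r))" ..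
      moreover have "k' r \<in> flat T" if "r \<in> {1..N + M}" for r
      proof (cases "r \<le> N")
        case True
        then show ?thesis using A(1) that by (simp add: k'_def)
      next
        case False
        then have "r - N \<in> {1..M}" using that by auto
        then show ?thesis using False B(1) by (simp add: k'_def)
      qed
      ultimately show ?case by blast
    qed
    then obtain N p k where k: "\<forall>r\<in>{1..N::nat}. k r \<in> flat T"
      and A: "A = (\<Sum>r = 1..N. mult_op T (p r) \<circ> conv_op T (k r))" by blast
    define K where "K = (\<lambda>t s. if 0 \<le> s \<and> s \<le> t \<and> t \<le> T
      then \<Sum>r = 1..N. poly (p r) (of_real t) * k r (t - s) else 0)"
    have "A = kernel_op T K"
      unfolding A K_def by (rule kernel_op_eq_sum[OF k, symmetric])
    moreover have "K \<in> flat_kernels T"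
      unfolding flat_kernels_def K_def using k by blast
    ultimately show "A \<in> flat_volterra T"
      unfolding flat_volterra_def by blast
  qed
qed

end

definition diff_part :: "real \<Rightarrow> (real \<Rightarrow> complex poly) \<Rightarrow> oper" where
  "diff_part T p = (\<Sum>\<gamma> | p \<gamma> \<noteq> 0. mult_op T (p \<gamma>) \<circ> deriv_op T \<gamma>)"

lemma finite_below_strict:
  fixes a :: real
  assumes "finite S" "\<And>x. x \<in> S \<Longrightarrow> x < a"
  shows "\<exists>c<a. \<forall>x\<in>S. x \<le> c"
proof (cases "S = {}")
  case True
  then show ?thesis by (intro exI[of _ "a - 1"]) simp
next
  case False
  then show ?thesis using assms by (intro exI[of _ "Max S"]) simp
qed

context interval
begin

lemma normal_form_iff:
  "normal_form T \<Gamma> A p K \<longleftrightarrow> finite {\<gamma>. p \<gamma> \<noteq> 0} \<and> {\<gamma>. p \<gamma> \<noteq> 0} \<subseteq> \<Gamma> \<and> K \<in> flat_kernels T \<and>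
     A = diff_part T p + kernel_op T K"
  by (simp add: normal_form_def diff_part_def)

lemma diff_part_superset:
  assumes "finite F" "{\<gamma>. p \<gamma> \<noteq> 0} \<subseteq> F"
  shows "diff_part T p = (\<Sum>\<gamma>\<in>F. mult_op T (p \<gamma>) \<circ> deriv_op T \<gamma>)"
  unfolding diff_part_def using assms
  by (intro sum.mono_neutral_left) (auto simp: mult_op_zero zero_compose)

lemma diff_part_single: "diff_part T (\<lambda>\<gamma>. if \<gamma> = a then P else 0) = mult_op T P \<circ> deriv_op T a"
  by (subst diff_part_superset[of "{a}"]) auto

lemma diff_part_zero: "diff_part T (\<lambda>\<gamma>. 0) = 0"
  by (simp add: diff_part_def)

lemma diff_part_add:
  assumes "finite {\<gamma>. p \<gamma> \<noteq> 0}" "finite {\<gamma>. q \<gamma> \<noteq> 0}"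
  shows "diff_part T (\<lambda>\<gamma>. p \<gamma> + q \<gamma>) = diff_part T p + diff_part T q"
proof -
  let ?F = "{\<gamma>. p \<gamma> \<noteq> 0} \<union> {\<gamma>. q \<gamma> \<noteq> 0}"
  have F: "finite ?F" using assms by simp
  have "{\<gamma>. p \<gamma> + q \<gamma> \<noteq> 0} \<subseteq> ?F" by auto
  then show ?thesis
    using diff_part_superset[OF F, of p] diff_part_superset[OF F, of q]
      diff_part_superset[OF F, of "\<lambda>\<gamma>. p \<gamma> + q \<gamma>"]
    by (simp add: mult_op_add compose_add_left sum.distrib)
qed

lemma diff_part_split:
  assumes "finite {\<gamma>. p \<gamma> \<noteq> 0}"
  shows "diff_part T p = (mult_op T (p a) \<circ> deriv_op T a) + diff_part T (p(a := 0))"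
proof -
  have "p = (\<lambda>\<gamma>. (if \<gamma> = a then p a else 0) + (p(a := 0)) \<gamma>)" by auto
  then have "diff_part T p = diff_part T (\<lambda>\<gamma>. (if \<gamma> = a then p a else 0) + (p(a := 0)) \<gamma>)" by simp
  also have "\<dots> = diff_part T (\<lambda>\<gamma>. if \<gamma> = a then p a else 0) + diff_part T (p(a := 0))"
  proof (rule diff_part_add)
    show "finite {\<gamma>. (if \<gamma> = a then p a else 0) \<noteq> 0}"
      by (rule finite_subset[of _ "{a}"]) auto
    show "finite {\<gamma>. (p(a := 0)) \<gamma> \<noteq> 0}"
      by (rule finite_subset[OF _ assms]) auto
  qed
  finally show ?thesis by (simp add: diff_part_single)
qed

lemma diff_part_order_le:
  assumes "finite {\<gamma>. p \<gamma> \<noteq> 0}" "{\<gamma>. p \<gamma> \<noteq> 0} \<subseteq> \<Gamma>" "\<And>\<gamma>. p \<gamma> \<noteq> 0 \<Longrightarrow> \<gamma> \<le> r"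
  shows "diff_part T p \<in> order_le T \<Gamma> r"
  unfolding diff_part_def using assms by (intro sum_order_le order_le.diff) auto

lemma kernel_op_smoothing: "K \<in> flat_kernels T \<Longrightarrow> kernel_op T K \<in> smoothing T"
  by (simp add: flat_volterra_def flip: flat_volterra_eq_smoothing)

lemma smoothing_kernel_op: "A \<in> smoothing T \<Longrightarrow> \<exists>K\<in>flat_kernels T. A = kernel_op T K"
  by (auto simp: flat_volterra_def simp flip: flat_volterra_eq_smoothing)

lemma normal_form_order_le:
  assumes "normal_form T \<Gamma> A p K" "\<And>\<gamma>. p \<gamma> \<noteq> 0 \<Longrightarrow> \<gamma> \<le> r"
  shows "A \<in> order_le T \<Gamma> r"
proof -
  have "kernel_op T K \<in> smoothing T" "A = diff_part T p + kernel_op T K"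
    using assms(1) by (simp_all add: normal_form_iff kernel_op_smoothing)
  moreover have "diff_part T p \<in> order_le T \<Gamma> r"
    using assms by (intro diff_part_order_le) (simp_all add: normal_form_iff)
  ultimately show ?thesis by (simp add: order_le.add order_le.smooth)
qed

lemma order_le_normal_form:
  "A \<in> order_le T \<Gamma> r \<Longrightarrow> \<exists>p K. normal_form T \<Gamma> A p K \<and> (\<forall>\<gamma>. p \<gamma> \<noteq> 0 \<longrightarrow> \<gamma> \<le> r)"
proof (induction rule: order_le.induct)
  case (diff \<gamma> P)
  obtain K where K: "K \<in> flat_kernels T" "kernel_op T K = 0"
    using smoothing_kernel_op[OF zero_smoothing] by metis
  let ?p = "\<lambda>x. if x = \<gamma> then P else 0"
  have "finite {x. ?p x \<noteq> 0}" by (rule finite_subset[of _ "{\<gamma>}"]) auto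
  moreover have "mult_op T P \<circ> deriv_op T \<gamma> = diff_part T ?p + kernel_op T K"
    by (simp add: diff_part_single K)
  ultimately have "normal_form T \<Gamma> (mult_op T P \<circ> deriv_op T \<gamma>) ?p K"
    using diff(1) K(1) unfolding normal_form_iff by auto
  then show ?case using diff(2) by (intro exI[of _ ?p] exI[of _ K]) auto
next
  case (smooth A)
  then obtain K where "K \<in> flat_kernels T" "A = kernel_op T K"
    using smoothing_kernel_op by blast
  then have "normal_form T \<Gamma> A (\<lambda>\<gamma>. 0) K"
    by (simp add: normal_form_iff diff_part_zero)
  then show ?case by (intro exI[of _ "\<lambda>\<gamma>. 0"] exI[of _ K]) simp
next
  case (add A B)
  then obtain p K q L where
    p: "normal_form T \<Gamma> A p K" "\<forall>\<gamma>. p \<gamma> \<noteq> 0 \<longrightarrow> \<gamma> \<le> r" and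
    q: "normal_form T \<Gamma> B q L" "\<forall>\<gamma>. q \<gamma> \<noteq> 0 \<longrightarrow> \<gamma> \<le> r"
    by blast
  obtain M where M: "M \<in> flat_kernels T" "kernel_op T K + kernel_op T L = kernel_op T M"
    using smoothing_kernel_op[OF smoothing.add] p(1) q(1) kernel_op_smoothing
    unfolding normal_form_iff by metis
  let ?s = "\<lambda>\<gamma>. p \<gamma> + q \<gamma>"
  have sub: "{\<gamma>. ?s \<gamma> \<noteq> 0} \<subseteq> {\<gamma>. p \<gamma> \<noteq> 0} \<union> {\<gamma>. q \<gamma> \<noteq> 0}" by auto
  have "finite {\<gamma>. ?s \<gamma> \<noteq> 0}"
    using p(1) q(1) unfolding normal_form_iff by (intro finite_subset[OF sub]) simp
  moreover have "A + B = diff_part T ?s + kernel_op T M"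
    using p(1) q(1) unfolding normal_form_iff M(2)[symmetric] by (simp add: diff_part_add ac_simps)
  moreover have "{\<gamma>. ?s \<gamma> \<noteq> 0} \<subseteq> \<Gamma>"
    using sub p(1) q(1) unfolding normal_form_iff by blast
  ultimately have "normal_form T \<Gamma> (A + B) ?s M"
    using M(1) unfolding normal_form_iff by blast
  moreover have "\<forall>\<gamma>. ?s \<gamma> \<noteq> 0 \<longrightarrow> \<gamma> \<le> r"
    using p(2) q(2) by (metis add_0)
  ultimately show ?case by blast
qed

text \<open>
  Subtracting the two forms leaves a vanishing operator whose leading coefficient is the difference of the
  coefficients at the largest exponent where they disagree.
\<close>

lemma normal_form_unique:
  assumes "normal_form T \<Gamma> A p K" "normal_form T \<Gamma> A q L"
  shows "p = q"
proof (rule ccontr)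
  assume "p \<noteq> q"
  define d where "d = (\<lambda>\<gamma>. p \<gamma> - q \<gamma>)"
  define a where "a = Max {\<gamma>. d \<gamma> \<noteq> 0}"
  have pf: "finite {\<gamma>. p \<gamma> \<noteq> 0}" "finite {\<gamma>. q \<gamma> \<noteq> 0}"
    and \<Gamma>: "{\<gamma>. p \<gamma> \<noteq> 0} \<subseteq> \<Gamma>" "{\<gamma>. q \<gamma> \<noteq> 0} \<subseteq> \<Gamma>"
    using assms by (simp_all add: normal_form_iff)
  have sub: "{\<gamma>. d \<gamma> \<noteq> 0} \<subseteq> {\<gamma>. p \<gamma> \<noteq> 0} \<union> {\<gamma>. q \<gamma> \<noteq> 0}"
    by (auto simp: d_def)
  have fin: "finite {\<gamma>. d \<gamma> \<noteq> 0}" using pf by (intro finite_subset[OF sub]) simp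
  have "{\<gamma>. d \<gamma> \<noteq> 0} \<noteq> {}" using \<open>p \<noteq> q\<close> by (auto simp: d_def fun_eq_iff)
  then have a: "d a \<noteq> 0" "\<And>\<gamma>. d \<gamma> \<noteq> 0 \<Longrightarrow> \<gamma> \<le> a"
    using Max_in[OF fin] Max_ge[OF fin] by (auto simp: a_def)
  have fin': "finite {\<gamma>. (d(a := 0)) \<gamma> \<noteq> 0}" by (rule finite_subset[OF _ fin]) auto
  have "\<And>\<gamma>. \<gamma> \<in> {\<gamma>. (d(a := 0)) \<gamma> \<noteq> 0} \<Longrightarrow> \<gamma> < a"
    using a(2) by (auto simp: le_less split: if_splits)
  then obtain c where c: "c < a" "\<And>\<gamma>. (d(a := 0)) \<gamma> \<noteq> 0 \<Longrightarrow> \<gamma> \<le> c"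
    using finite_below_strict[OF fin', of a] by blast
  let ?X = "diff_part T (d(a := 0)) + (kernel_op T K + (mult_op T [:- 1:] \<circ> kernel_op T L))"
  have sm: "kernel_op T K \<in> smoothing T" "kernel_op T L \<in> smoothing T"
    using assms kernel_op_smoothing by (simp_all add: normal_form_iff)
  have "{\<gamma>. (d(a := 0)) \<gamma> \<noteq> 0} \<subseteq> \<Gamma>" using sub \<Gamma> by auto
  then have X: "?X \<in> order_le T \<Gamma> c"
    by (intro order_le.add order_le.smooth sm mult_op_smoothing diff_part_order_le fin' c(2)) auto
  have "p = (\<lambda>\<gamma>. d \<gamma> + q \<gamma>)" by (simp add: d_def)
  then have "diff_part T p = diff_part T d + diff_part T q"
    using diff_part_add[OF fin pf(2)] by simp
  moreover have "diff_part T p + kernel_op T K = diff_part T q + kernel_op T L"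
    using assms by (simp add: normal_form_iff)
  ultimately have "diff_part T d + kernel_op T K = kernel_op T L"
    by (simp add: add.assoc add.left_commute)
  then have "(diff_part T d + kernel_op T K) + (mult_op T [:- 1:] \<circ> kernel_op T L) = 0"
    using minus_compose[OF flat_linear_smoothing[OF sm(2)]] by simp
  then have "(mult_op T (d a) \<circ> deriv_op T a) + ?X = 0"
    unfolding diff_part_split[OF fin, of a] by (simp only: add.assoc)
  then show False using leading_term_nonzero[OF a(1) c(1) X] by blast
qed

lemma coeffs_of_eq: "normal_form T \<Gamma> A p K \<Longrightarrow> coeffs_of T \<Gamma> A = p"
  unfolding coeffs_of_def by (rule the_equality) (auto intro: normal_form_unique)

section \<open>The order filtration\<close>

lemma ord_op_eq_Max:
  assumes "normal_form T \<Gamma> A p K" "A \<notin> flat_volterra T"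
  shows "ord_op T \<Gamma> A = ereal (Max {\<gamma>. p \<gamma> \<noteq> 0})" "finite {\<gamma>. p \<gamma> \<noteq> 0}" "{\<gamma>. p \<gamma> \<noteq> 0} \<noteq> {}"
proof -
  show "ord_op T \<Gamma> A = ereal (Max {\<gamma>. p \<gamma> \<noteq> 0})"
    using assms by (simp add: ord_op_def coeffs_of_eq)
  show "finite {\<gamma>. p \<gamma> \<noteq> 0}" using assms by (simp add: normal_form_iff)
  show "{\<gamma>. p \<gamma> \<noteq> 0} \<noteq> {}"
  proof
    assume "{\<gamma>. p \<gamma> \<noteq> 0} = {}"
    then have "diff_part T p = 0" by (simp add: diff_part_def)
    then show False
      using assms kernel_op_smoothing by (simp add: normal_form_iff flat_volterra_eq_smoothing)
  qed
qed

lemma ord_op_le_iff: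
  assumes "A \<in> order_le T \<Gamma> s"
  shows "ord_op T \<Gamma> A \<le> ereal r \<longleftrightarrow> A \<in> order_le T \<Gamma> r"
proof (cases "A \<in> flat_volterra T")
  case True
  then show ?thesis
    by (simp add: ord_op_def order_le.smooth flip: flat_volterra_eq_smoothing)
next
  case False
  show ?thesis
  proof
    assume le: "ord_op T \<Gamma> A \<le> ereal r"
    obtain p K where nf: "normal_form T \<Gamma> A p K"
      using order_le_normal_form[OF assms] by blast
    note M = ord_op_eq_Max[OF nf False]
    show "A \<in> order_le T \<Gamma> r"
      using le M by (intro normal_form_order_le[OF nf]) (simp add: Max_le_iff)
  next
    assume "A \<in> order_le T \<Gamma> r"
    then obtain p K where nf: "normal_form T \<Gamma> A p K" "\<forall>\<gamma>. p \<gamma> \<noteq> 0 \<longrightarrow> \<gamma> \<le> r"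
      using order_le_normal_form by blast
    note M = ord_op_eq_Max[OF nf(1) False]
    show "ord_op T \<Gamma> A \<le> ereal r"
      using M nf(2) by simp
  qed
qed

lemma leading_term:
  assumes "A \<in> order_le T \<Gamma> s" "A \<notin> flat_volterra T"
  obtains a P c X where "ord_op T \<Gamma> A = ereal a" "a \<in> \<Gamma>" "P \<noteq> 0" "c < a" "X \<in> order_le T \<Gamma> c"
    "A = (mult_op T P \<circ> deriv_op T a) + X"
proof -
  obtain p K where nf: "normal_form T \<Gamma> A p K"
    using order_le_normal_form[OF assms(1)] by blast
  note M = ord_op_eq_Max[OF nf assms(2)]
  define a where "a = Max {\<gamma>. p \<gamma> \<noteq> 0}"
  have a: "p a \<noteq> 0" "\<And>\<gamma>. p \<gamma> \<noteq> 0 \<Longrightarrow> \<gamma> \<le> a"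
    using Max_in[OF M(2,3)] Max_ge[OF M(2)] by (auto simp: a_def)
  have fin: "finite {\<gamma>. (p(a := 0)) \<gamma> \<noteq> 0}" by (rule finite_subset[OF _ M(2)]) auto
  have "\<And>\<gamma>. \<gamma> \<in> {\<gamma>. (p(a := 0)) \<gamma> \<noteq> 0} \<Longrightarrow> \<gamma> < a"
    using a(2) by (auto simp: le_less split: if_splits)
  then obtain c where c: "c < a" "\<And>\<gamma>. (p(a := 0)) \<gamma> \<noteq> 0 \<Longrightarrow> \<gamma> \<le> c"
    using finite_below_strict[OF fin, of a] by blast
  have "{\<gamma>. (p(a := 0)) \<gamma> \<noteq> 0} \<subseteq> \<Gamma>" using nf by (auto simp: normal_form_iff)
  then have "normal_form T \<Gamma> (diff_part T (p(a := 0)) + kernel_op T K) (p(a := 0)) K"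
    using nf fin unfolding normal_form_iff by blast
  then have X: "diff_part T (p(a := 0)) + kernel_op T K \<in> order_le T \<Gamma> c"
    by (rule normal_form_order_le) (rule c(2))
  have "A = diff_part T p + kernel_op T K" using nf by (simp add: normal_form_iff)
  then have "A = (mult_op T (p a) \<circ> deriv_op T a) + (diff_part T (p(a := 0)) + kernel_op T K)"
    unfolding diff_part_split[OF M(2), of a] by (simp only: add.assoc)
  moreover have "a \<in> \<Gamma>" using nf a(1) by (auto simp: normal_form_iff)
  ultimately show thesis using that M(1) a(1) c(1) X unfolding a_def[symmetric] by blast
qed

text \<open>
  Any way of writing an operator with a nonzero leading coefficient shows its order: were the order smaller,
  the leading term would equal an operator of lower order.
\<close>

lemma ord_op_eqI:
  assumes "a \<in> \<Gamma>" "P \<noteq> 0" "c < a" "X \<in> order_le T \<Gamma> c"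
  shows "ord_op T \<Gamma> ((mult_op T P \<circ> deriv_op T a) + X) = ereal a" (is "ord_op T \<Gamma> ?A = _")
proof (rule antisym)
  have A: "?A \<in> order_le T \<Gamma> a"
    using assms(3) by (intro order_le.add order_le.diff assms order_le_mono[OF assms(4)]) auto
  then show "ord_op T \<Gamma> ?A \<le> ereal a" using ord_op_le_iff by blast
  show "ereal a \<le> ord_op T \<Gamma> ?A"
  proof (rule ccontr)
    assume "\<not> ereal a \<le> ord_op T \<Gamma> ?A"
    then have "ord_op T \<Gamma> ?A < ereal a" by (simp only: not_le)
    then obtain r where r: "ord_op T \<Gamma> ?A < ereal r" "r < a"
      using ereal_dense2[of "ord_op T \<Gamma> ?A" "ereal a"] by auto
    then have low: "?A \<in> order_le T \<Gamma> r"
      using ord_op_le_iff[OF A, of r] by (metis less_imp_le)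
    let ?Y = "X + (mult_op T [:- 1:] \<circ> ?A)"
    have "?Y \<in> order_le T \<Gamma> (max c r)"
      by (intro order_le.add order_le_mono[OF assms(4)] order_le_mono[OF mult_op_order_le[OF low]]) simp_all
    moreover have "(mult_op T P \<circ> deriv_op T a) + ?Y = 0"
      using minus_compose[OF flat_linear_order_le[OF A]] by (simp only: add.assoc)
    ultimately show False
      using leading_term_nonzero[OF assms(2)] assms(3) r(2) by (metis max_less_iff_conj)
  qed
qed

lemma smoothing_frac_alg: "A \<in> smoothing T \<Longrightarrow> A \<in> frac_alg T \<Gamma>"
  by (induction rule: smoothing.induct)
    (simp_all add: frac_alg.comp frac_alg.mult frac_alg.conv frac_alg.add)

lemma order_le_frac_alg: "A \<in> order_le T \<Gamma> r \<Longrightarrow> A \<in> frac_alg T \<Gamma>"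
  by (induction rule: order_le.induct)
    (simp_all add: frac_alg.comp frac_alg.mult frac_alg.deriv frac_alg.add smoothing_frac_alg)

end

context exponent_group
begin

lemma frac_alg_order_le: "A \<in> frac_alg T \<Gamma> \<Longrightarrow> \<exists>r. A \<in> order_le T \<Gamma> r"
proof (induction rule: frac_alg.induct)
  case (mult p)
  have "mult_op T p \<circ> deriv_op T 0 \<in> order_le T \<Gamma> 0"
    by (rule order_le.diff[OF zero_in order_refl])
  then show ?case using deriv_op_0_right[OF flat_linear_mult_op, of p] by metis
next
  case (deriv \<gamma>)
  have "mult_op T 1 \<circ> deriv_op T \<gamma> \<in> order_le T \<Gamma> \<gamma>"
    by (rule order_le.diff[OF deriv order_refl])
  then show ?case using one_compose[OF flat_linear_deriv_op, of \<gamma>] by metis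
next
  case (conv k)
  have "mult_op T 1 \<circ> conv_op T k \<in> order_le T \<Gamma> 0"
    by (rule order_le.smooth[OF smoothing.base[OF conv]])
  then show ?case using one_compose[OF flat_linear_conv_op[OF conv]] by metis
next
  case (add A B)
  then obtain r s where A: "A \<in> order_le T \<Gamma> r" and B: "B \<in> order_le T \<Gamma> s" by blast
  have "A + B \<in> order_le T \<Gamma> (max r s)"
    by (intro order_le.add order_le_mono[OF A] order_le_mono[OF B]) simp_all
  then show ?case by blast
next
  case (scale A c)
  then obtain r where A: "A \<in> order_le T \<Gamma> r" by blast
  show ?case
    using mult_op_order_le[OF A] cscale_eq[OF flat_linear_order_le[OF A]] by metis
next
  case (comp A B)
  then show ?case using order_le_compose by blast
qed

text \<open>
  Reduces all claims on the filtration to closure properties of \<open>order_le T \<Gamma> r\<close>.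
\<close>

lemma filt_eq_order_le: "filt T \<Gamma> r = order_le T \<Gamma> r"
  unfolding filt_def using frac_alg_order_le ord_op_le_iff order_le_frac_alg by blast

lemma ord_op_compose:
  assumes "A \<in> frac_alg T \<Gamma>" "B \<in> frac_alg T \<Gamma>" "A \<notin> flat_volterra T" "B \<notin> flat_volterra T"
  shows "ord_op T \<Gamma> (A \<circ> B) = ord_op T \<Gamma> A + ord_op T \<Gamma> B"
proof -
  obtain s s' where s: "A \<in> order_le T \<Gamma> s" "B \<in> order_le T \<Gamma> s'"
    using assms(1,2) frac_alg_order_le by blast
  obtain a P c X where A: "ord_op T \<Gamma> A = ereal a" "a \<in> \<Gamma>" "P \<noteq> 0" "c < a" "X \<in> order_le T \<Gamma> c"
    "A = (mult_op T P \<circ> deriv_op T a) + X"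
    using leading_term[OF s(1) assms(3)] by blast
  obtain b Q d Y where B: "ord_op T \<Gamma> B = ereal b" "b \<in> \<Gamma>" "Q \<noteq> 0" "d < b" "Y \<in> order_le T \<Gamma> d"
    "B = (mult_op T Q \<circ> deriv_op T b) + Y"
    using leading_term[OF s(2) assms(4)] by blast
  let ?A = "mult_op T P \<circ> deriv_op T a" and ?B = "mult_op T Q \<circ> deriv_op T b"
  obtain C where C: "C \<in> order_le T \<Gamma> (a + b - 1)"
    "?A \<circ> ?B = (mult_op T (P * Q) \<circ> deriv_op T (a + b)) + C"
    using leading_term_compose[OF A(2) B(2)] by blast
  have Ble: "B \<in> order_le T \<Gamma> b"
    using ord_op_le_iff[OF s(2), of b] B(1) by simp
  have Ale: "?A \<in> order_le T \<Gamma> a" using A(2) by (simp add: order_le.diff)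
  note AY = order_le_compose[OF Ale B(5)] and XB = order_le_compose[OF A(5) Ble]
  \<comment> \<open>the orders of the commutator and of the two kinds of products that involve a lower-order part\<close>
  define e where "e = max (a + b - 1) (max (a + d) (c + b))"
  have "C + ((?A \<circ> Y) + (X \<circ> B)) \<in> order_le T \<Gamma> e"
    unfolding e_def
    by (intro order_le.add order_le_mono[OF C(1)] order_le_mono[OF AY] order_le_mono[OF XB]) auto
  moreover have "e < a + b" using A(4) B(4) by (simp add: e_def)
  moreover have "A \<circ> B = (mult_op T (P * Q) \<circ> deriv_op T (a + b)) + (C + ((?A \<circ> Y) + (X \<circ> B)))"
  proof -
    have "A \<circ> B = (?A \<circ> B) + (X \<circ> B)"
      unfolding A(6) compose_add_left ..
    also have "?A \<circ> B = (?A \<circ> ?B) + (?A \<circ> Y)"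
      unfolding B(6)
      by (intro compose_add_right flat_linear_intros flat_linear_order_le[OF B(5)])
    finally show ?thesis unfolding C(2) by (simp only: add.assoc)
  qed
  ultimately have "ord_op T \<Gamma> (A \<circ> B) = ereal (a + b)"
    using A(2,3) B(2,3) by (simp only: ord_op_eqI add_closed mult_eq_0_iff simp_thms)
  then show ?thesis using A(1) B(1) by simp
qed

end

theorem corollary2:
  fixes T :: real and \<Gamma> :: "real set"
  assumes "T > 0"
    and "0 \<in> \<Gamma>"
    and "\<And>x y. x \<in> \<Gamma> \<Longrightarrow> y \<in> \<Gamma> \<Longrightarrow> x + y \<in> \<Gamma>"
    and "\<And>x. x \<in> \<Gamma> \<Longrightarrow> - x \<in> \<Gamma>"
    and "\<int> \<subseteq> \<Gamma>"
  shows "(\<forall>A \<in> frac_alg T \<Gamma>. \<forall>B \<in> frac_alg T \<Gamma>.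
            A \<notin> flat_volterra T \<longrightarrow> B \<notin> flat_volterra T \<longrightarrow>
            ord_op T \<Gamma> (A \<circ> B) = ord_op T \<Gamma> A + ord_op T \<Gamma> B)
       \<and> mono (filt T \<Gamma>)
       \<and> (\<forall>r. module.subspace cscale (filt T \<Gamma> r))
       \<and> (\<forall>r s. {A \<circ> B | A B. A \<in> filt T \<Gamma> r \<and> B \<in> filt T \<Gamma> s} \<subseteq> filt T \<Gamma> (r + s))"
proof -
  interpret exponent_group T \<Gamma>
    using assms by unfold_locales
  interpret V: vector_space cscale by (rule vector_space_cscale)
  have "mono (filt T \<Gamma>)"
    by (intro monoI subsetI) (simp add: filt_eq_order_le order_le_mono)
  moreover have "V.subspace (filt T \<Gamma> r)" for r
  proof (rule V.subspaceI)
    show "0 \<in> filt T \<Gamma> r"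
      by (simp add: filt_eq_order_le order_le.smooth zero_smoothing)
    show "A + B \<in> filt T \<Gamma> r" if "A \<in> filt T \<Gamma> r" "B \<in> filt T \<Gamma> r" for A B
      using that by (simp add: filt_eq_order_le order_le.add)
    show "cscale c A \<in> filt T \<Gamma> r" if "A \<in> filt T \<Gamma> r" for c A
      using that by (simp add: filt_eq_order_le cscale_eq flat_linear_order_le mult_op_order_le)
  qed
  moreover have "{A \<circ> B | A B. A \<in> filt T \<Gamma> r \<and> B \<in> filt T \<Gamma> s} \<subseteq> filt T \<Gamma> (r + s)" for r s
    by (auto simp: filt_eq_order_le order_le_compose)
  ultimately show ?thesis using ord_op_compose by blast
qed

end
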